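(* Let $\lambda,\mu\in\mathbb{R}^n$ be weakly decreasing such that $\mu_k>\mu_{k+1}$ for all $1\le k\le n-1$ with $\lambda_k>\lambda_{k+1}$. Let $N\in\mathfrak{u}_n$ with $-N\in\mathcal{O}_\mu$, and consider the gradient flow of $L\mapsto\mathrm{tr}(LN)$ on $\mathcal{O}_\lambda$ in the Kähler metric. Let $S$ be a nonempty compact subset of the stable manifold $\mathcal{O}_\lambda^s(N)$ of the global attractor, such that any flow beginning in $S$ lies in the interior of $S$ (inside $\mathcal{O}_\lambda$) for all positive time. Then $S$ is homeomorphic to a closed ball, its interior is homeomorphic to an open ball, and its boundary (that is, $S$ minus its interior) is homeomorphic to a sphere.
   Context: Here $\mathrm{i}=\sqrt{-1}$; $\mathrm{U}_n$ is the unitary group and $\mathfrak{u}_n$ the Lie algebra of skew-Hermitian $n\times n$ matrices. For weakly decreasing $\lambda\in\mathbb{R}^n$, $\mathcal{O}_\lambda=\{g(\mathrm{i}\,\mathrm{Diag}(\lambda))g^{-1}:g\in\mathrm{U}_n\}$. Let $\kappa(L,M)=2n\,\mathrm{tr}(LM)-2\,\mathrm{tr}(L)\mathrm{tr}(M)$ and $\mathrm{ad}_L(X)=[L,X]=LX-XL$. The tangent space of $\mathcal{O}_\lambda$ at $L$ is $\{[L,X]:X\in\mathfrak{u}_n\}$. For $X\in\mathfrak{u}_n$ write $X=X^L+X_L$ with $X^L\in\mathrm{im}(\mathrm{ad}_L)$, $X_L\in\ker(\mathrm{ad}_L)$ (uniquely). The normal metric is $\langle[L,X],[L,Y]\rangle_{\mathrm{normal}}=-\kappa(X^L,Y^L)$,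 and the Kähler metric is $\langle[L,X],[L,Y]\rangle_{\mathrm{K\ddot ahler}}=\langle\sqrt{-\mathrm{ad}_L^2}\,([L,X]),[L,Y]\rangle_{\mathrm{normal}}$, with $\sqrt{-\mathrm{ad}_L^2}$ the positive square root of the positive semidefinite operator $-\mathrm{ad}_L^2$. The gradient flow of a function $H$ is the solution of $\dot L(t)=\mathrm{grad}(H)(L(t))$ (steepest ascent), defined for all $t\in\mathbb{R}$. The Hermitian matrix $\mathrm{i}N$ has eigenvalues $\mu_1\ge\dots\ge\mu_n$. For each $k$ with $\mu_k>\mu_{k+1}$ let $P_k$ be the orthogonal projection of $\mathbb{C}^n$ onto the $k$-dimensional span of the eigenvectors of $\mathrm{i}N$ with eigenvalues $\mu_1,\dots,\mu_k$. The global attractor is the point $L^\infty=\big(\sum_{k:\,\lambda_k>\lambda_{k+1}}(\lambda_k-\lambda_{k+1})\,\mathrm{i}P_k\big)+\lambda_n\mathrm{i}I_n\in\mathcal{O}_\lambda$, and its stable manifold is $\mathcal{O}_\lambda^s(N)=\{L_0\in\mathcal{O}_\lambda: L(t)\to L^\infty\text{ as }t\to\infty\}$, where $L(t)$ is the gradient flow with $L(0)=L_0$. *)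

theory Defs
  imports "HOL-Analysis.Analysis"
begin

text \<open>
  The dimension n is \<open>CARD('n)\<close> for a finite linearly ordered index type \<open>'n\<close>.
  Real n-tuples are functions \<open>nat \<Rightarrow> real\<close> of which only the values at \<open>1, \<dots>, CARD('n)\<close> matter;
  \<open>idx i\<close> is the position (counted from 1) of the matrix index \<open>i\<close>.
\<close>

type_synonym 'n cmat = "complex ^ 'n ^ 'n"

definition idx :: "'n :: {finite, linorder} \<Rightarrow> nat" where
  "idx i = card {j. j \<le> i}"

definition cscale :: "complex \<Rightarrow> 'n::finite cmat \<Rightarrow> 'n cmat" where
  "cscale c A = map_matrix (\<lambda>z. c * z) A"

definition conj_transpose :: "'n::finite cmat \<Rightarrow> 'n cmat" where
  "conj_transpose A = map_matrix cnj (transpose A)"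

definition unitary_group :: "'n::finite cmat set" where
  "unitary_group = {g. g ** conj_transpose g = mat 1 \<and> conj_transpose g ** g = mat 1}"

definition skew_herm :: "'n::finite cmat set" where
  "skew_herm = {X. conj_transpose X = - X}"

definition Diag :: "(nat \<Rightarrow> real) \<Rightarrow> 'n :: {finite, linorder} cmat" where
  "Diag l = (\<chi> i j. if i = j then complex_of_real (l (idx i)) else 0)"

definition orbit :: "(nat \<Rightarrow> real) \<Rightarrow> 'n :: {finite, linorder} cmat set" where
  "orbit l = {g ** cscale \<i> (Diag l) ** matrix_inv g | g. g \<in> unitary_group}"

definition ad :: "'n::finite cmat \<Rightarrow> 'n cmat \<Rightarrow> 'n cmat" where
  "ad L X = L ** X - X ** L"

definition kappa :: "'n::finite cmat \<Rightarrow> 'n cmat \<Rightarrow> complex" where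
  "kappa L M = 2 * of_nat CARD('n) * trace (L ** M) - 2 * trace L * trace M"

text \<open>
  The set below is at the same time the image of \<open>ad L\<close> on skew-Hermitian matrices and the
  tangent space at \<open>L\<close> of the orbit through \<open>L\<close>.
\<close>

definition im_ad :: "'n::finite cmat \<Rightarrow> 'n cmat set" where
  "im_ad L = ad L ` skew_herm"

definition ker_ad :: "'n::finite cmat \<Rightarrow> 'n cmat set" where
  "ker_ad L = {X \<in> skew_herm. ad L X = 0}"

definition im_part :: "'n::finite cmat \<Rightarrow> 'n cmat \<Rightarrow> 'n cmat" where
  "im_part L X = (THE A. A \<in> im_ad L \<and> X - A \<in> ker_ad L)"

text \<open>
  On tangent vectors \<open>V = [L,X]\<close>, \<open>W = [L,Y]\<close> the value does not depend on the choice of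
  \<open>X\<close>, \<open>Y\<close>. Since \<open>kappa\<close> is real on skew-Hermitian matrices, \<open>Re\<close> only changes the type.
\<close>

definition normal_metric :: "'n::finite cmat \<Rightarrow> 'n cmat \<Rightarrow> 'n cmat \<Rightarrow> real" where
  "normal_metric L V W =
     (THE r. \<exists>X\<in>skew_herm. \<exists>Y\<in>skew_herm.
        V = ad L X \<and> W = ad L Y \<and> r = - Re (kappa (im_part L X) (im_part L Y)))"

text \<open>
  \<open>R\<close> is a positive semidefinite square root, on the real subspace \<open>U\<close>, of the operator \<open>T\<close>.
  The library inner product of matrices is \<open>X \<bullet> Y = Re (trace (X ** conj_transpose Y))\<close>, which is
  \<open>- Re (trace (X ** Y))\<close> on skew-Hermitian matrices.
\<close>

definition psd_sqrt_on :: "'v::real_inner set \<Rightarrow> ('v \<Rightarrow> 'v) \<Rightarrow> ('v \<Rightarrow> 'v) \<Rightarrow> bool" where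
  "psd_sqrt_on U T R \<longleftrightarrow>
     linear R \<and> R ` U \<subseteq> U \<and>
     (\<forall>x\<in>U. \<forall>y\<in>U. R x \<bullet> y = x \<bullet> R y) \<and>
     (\<forall>x\<in>U. 0 \<le> R x \<bullet> x) \<and>
     (\<forall>x\<in>U. R (R x) = T x)"

text \<open>\<open>R\<close> is unique on \<open>skew_herm\<close> (not outside), so the value is determined for \<open>V \<in> skew_herm\<close>.\<close>

definition sqrt_neg_ad_sq :: "'n::finite cmat \<Rightarrow> 'n cmat \<Rightarrow> 'n cmat" where
  "sqrt_neg_ad_sq L V =
     (THE W. \<exists>R. psd_sqrt_on skew_herm (\<lambda>X. - ad L (ad L X)) R \<and> W = R V)"

definition kahler_metric :: "'n::finite cmat \<Rightarrow> 'n cmat \<Rightarrow> 'n cmat \<Rightarrow> real" where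
  "kahler_metric L V W = normal_metric L (sqrt_neg_ad_sq L V) W"

text \<open>
  Gradient, in the Kaehler metric, of the restriction to the orbit through \<open>L\<close> of a function \<open>H\<close>
  that is differentiable on the ambient matrix space; its differential is only evaluated on
  tangent vectors of the orbit.
\<close>

definition kahler_grad :: "('n::finite cmat \<Rightarrow> real) \<Rightarrow> 'n cmat \<Rightarrow> 'n cmat" where
  "kahler_grad H L =
     (THE G. G \<in> im_ad L \<and>
        (\<forall>V\<in>im_ad L. kahler_metric L G V = frechet_derivative H (at L) V))"

definition kahler_flow ::
    "(nat \<Rightarrow> real) \<Rightarrow> ('n::{finite, linorder} cmat \<Rightarrow> real) \<Rightarrow> (real \<Rightarrow> 'n cmat) \<Rightarrow> bool" where
  "kahler_flow l H L \<longleftrightarrow>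
     (\<forall>t. L t \<in> orbit l \<and> (L has_vector_derivative kahler_grad H (L t)) (at t))"

text \<open>The trace of a product of two skew-Hermitian matrices is real.\<close>

definition trace_fun :: "'n::finite cmat \<Rightarrow> 'n cmat \<Rightarrow> real" where
  "trace_fun N L = Re (trace (L ** N))"

definition herm_inner :: "complex ^ 'n \<Rightarrow> complex ^ 'n::finite \<Rightarrow> complex" where
  "herm_inner v w = (\<Sum>i\<in>UNIV. v $ i * cnj (w $ i))"

definition orth_proj :: "(complex ^ 'n::finite) set \<Rightarrow> 'n cmat" where
  "orth_proj E = (THE P. \<forall>v. P *v v \<in> E \<and> (\<forall>w\<in>E. herm_inner (v - P *v v) w = 0))"

text \<open>\<open>vec.span\<close> is the span over the complex numbers (\<open>span\<close> would be the real span).\<close>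

definition top_eigenspace :: "(nat \<Rightarrow> real) \<Rightarrow> 'n::finite cmat \<Rightarrow> nat \<Rightarrow> (complex ^ 'n) set" where
  "top_eigenspace m N k =
     vec.span {v. \<exists>j\<in>{1..k}. cscale \<i> N *v v = complex_of_real (m j) *s v}"

definition attractor ::
    "(nat \<Rightarrow> real) \<Rightarrow> (nat \<Rightarrow> real) \<Rightarrow> 'n::{finite, linorder} cmat \<Rightarrow> 'n cmat" where
  "attractor l m N =
     (\<Sum>k\<in>{k\<in>{1..<CARD('n)}. l k > l (k + 1)}.
        cscale (complex_of_real (l k - l (k + 1)) * \<i>) (orth_proj (top_eigenspace m N k)))
     + cscale (complex_of_real (l CARD('n)) * \<i>) (mat 1)"

definition stable_manifold ::
    "(nat \<Rightarrow> real) \<Rightarrow> (nat \<Rightarrow> real) \<Rightarrow> 'n::{finite, linorder} cmat \<Rightarrow> 'n cmat set" where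
  "stable_manifold l m N =
     {L0 \<in> orbit l. \<exists>L. kahler_flow l (trace_fun N) L \<and> L 0 = L0 \<and>
                        (L \<longlongrightarrow> attractor l m N) at_top}"

text \<open>
  Unit balls and sphere in Euclidean d-space, for every natural number d. The library's
  \<open>nsphere p\<close> is \<open>std_sphere (p + 1)\<close>; \<open>std_sphere 0\<close> is empty.
\<close>

definition std_cball :: "nat \<Rightarrow> (nat \<Rightarrow> real) topology" where
  "std_cball d = subtopology (Euclidean_space d) {x. (\<Sum>i<d. x i ^ 2) \<le> 1}"

definition std_ball :: "nat \<Rightarrow> (nat \<Rightarrow> real) topology" where
  "std_ball d = subtopology (Euclidean_space d) {x. (\<Sum>i<d. x i ^ 2) < 1}"

definition std_sphere :: "nat \<Rightarrow> (nat \<Rightarrow> real) topology" where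
  "std_sphere d = subtopology (Euclidean_space d) {x. (\<Sum>i<d. x i ^ 2) = 1}"

end

theory Submission
  imports Defs
begin

text \<open>
  In the Kaehler metric the gradient of \<open>L \<mapsto> tr (L N)\<close> at \<open>L = U (i Diag l) U\<^sup>\<dagger>\<close> has entries
  \<open>- \<bar>l i - l j\<bar> / (2 n) * (U\<^sup>\<dagger> N U) i j\<close> in the eigenbasis of \<open>L\<close>, which says that the spectral
  projections of \<open>L\<close> move like projections onto subspaces transported by \<open>exp (t A)\<close>, where
  \<open>A = i N / (2 n)\<close>. On the open cell of flags represented by matrices \<open>g (1 + x)\<close>, with \<open>g\<close>
  diagonalizing \<open>A\<close> and \<open>x\<close> strictly block lower triangular, the flow is therefore linear and
  diagonal, \<open>x i j \<mapsto> exp (t (a i - a j)) * x i j\<close>, and the gap hypothesis makes all the exponents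
  negative. A flow converging to the attractor eventually enters the cell, hence by uniqueness of
  solutions never left it. Raising the moduli of the coordinates to suitable powers
  turns the flow into the scaling \<open>y \<mapsto> exp (- t) y\<close>; the inward set \<open>S\<close> becomes a
  compact set that is strictly starlike about the origin, and such a set is a ball.
\<close>

section \<open>Complex matrices and unitary conjugation\<close>

text \<open>The flow contracts different coordinates at different rates, so its trajectories are
  curved in \<open>x\<close> and \<open>S\<close> need not be starlike there. The powers give all
  coordinates the rate one, which turns trajectories into rays. Eigenvalues of \<open>L\<close> may
  repeat, so \<open>L\<close> determines only a partial flag: the projection onto the first k
  columns of a diagonalizing \<open>U\<close> is a function of \<open>L\<close> only if
  \<open>lam\<close> drops strictly after position k. The vector field is therefore written as a sum
  over k weighted by the drops \<open>w k\<close>, which vanish where the projection is ambiguous.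
  The same weights make the field Lipschitz on the orbit, whence uniqueness of solutions; inside the
  cell solutions are explicit. The constant 2n comes from \<open>kappa\<close>, whose trace term
  drops out because the image of \<open>ad L\<close> has zero diagonal in an eigenbasis of
  \<open>L\<close>. The chart is given by a relation that involves a non-unique unitary factor. Its
  continuity and the openness of the cell are obtained topologically, from compactness of the
  unitary group and invariance of domain.\<close>

notation conj_transpose ("_\<^sup>\<dagger>" [1000] 999)

definition dg :: "('n \<Rightarrow> complex) \<Rightarrow> 'n::finite cmat" where
  "dg f = (\<chi> i j. if i = j then f i else 0)"

definition cj :: "'n::finite cmat \<Rightarrow> 'n cmat \<Rightarrow> 'n cmat" where
  "cj U A = U ** A ** U\<^sup>\<dagger>"

lemma mult_nth: "(A ** B) $ i $ j = (\<Sum>k\<in>UNIV. A $ i $ k * B $ k $ j)"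
  by (simp add: matrix_matrix_mult_def)

lemma conj_transpose_nth [simp]: "(A\<^sup>\<dagger>) $ i $ j = cnj (A $ j $ i)"
  by (simp add: conj_transpose_def map_matrix_def transpose_def)

lemma cscale_nth [simp]: "cscale c A $ i $ j = c * A $ i $ j"
  by (simp add: cscale_def map_matrix_def)

lemma dg_nth: "dg f $ i $ j = (if i = j then f i else 0)"
  by (simp add: dg_def)

lemma dg_mult_nth [simp]: "(dg f ** A) $ i $ j = f i * A $ i $ j"
  by (simp add: mult_nth dg_nth if_distrib[of "\<lambda>x. x * _"] cong: if_cong)

lemma mult_dg_nth [simp]: "(A ** dg f) $ i $ j = A $ i $ j * f j"
  by (simp add: mult_nth dg_nth if_distrib[of "\<lambda>x. _ * x"] cong: if_cong)

lemma mat_1_eq_dg: "(mat 1 :: 'n::finite cmat) = dg (\<lambda>_. 1)"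
  by (simp add: mat_def dg_def)

lemma dg_mult_dg: "dg f ** dg h = dg (\<lambda>i. f i * h i)"
  by (simp add: vec_eq_iff dg_nth)

lemma conj_transpose_dg: "(dg f)\<^sup>\<dagger> = dg (\<lambda>i. cnj (f i))"
  by (simp add: vec_eq_iff dg_nth)

lemma conj_transpose_mult: "(A ** B)\<^sup>\<dagger> = B\<^sup>\<dagger> ** A\<^sup>\<dagger>"
  by (simp add: vec_eq_iff mult_nth mult.commute)

lemma conj_transpose_invol [simp]: "(A\<^sup>\<dagger>)\<^sup>\<dagger> = A"
  by (simp add: vec_eq_iff)

lemma conj_transpose_mat_1 [simp]: "(mat 1)\<^sup>\<dagger> = mat 1"
  by (simp add: vec_eq_iff mat_def)

lemma conj_transpose_add: "(A + B)\<^sup>\<dagger> = A\<^sup>\<dagger> + B\<^sup>\<dagger>"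
  by (simp add: vec_eq_iff)

lemma conj_transpose_diff: "(A - B)\<^sup>\<dagger> = A\<^sup>\<dagger> - B\<^sup>\<dagger>"
  by (simp add: vec_eq_iff)

lemma conj_transpose_cscale: "(cscale c A)\<^sup>\<dagger> = cscale (cnj c) (A\<^sup>\<dagger>)"
  by (simp add: vec_eq_iff)

lemma conj_transpose_scaleR: "(r *\<^sub>R A)\<^sup>\<dagger> = r *\<^sub>R A\<^sup>\<dagger>"
  by (simp add: vec_eq_iff)

lemma scaleR_eq_cscale: "r *\<^sub>R A = cscale (of_real r) A"
  by (simp add: vec_eq_iff) (simp add: scaleR_conv_of_real)

lemma cscale_mult_left: "cscale c A ** B = cscale c (A ** B)"
  by (simp add: vec_eq_iff mult_nth sum_distrib_left mult_ac)

lemma cscale_mult_right: "A ** cscale c B = cscale c (A ** B)"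
  by (simp add: vec_eq_iff mult_nth sum_distrib_left mult_ac)

lemma cscale_cscale [simp]: "cscale a (cscale b A) = cscale (a * b) A"
  by (simp add: vec_eq_iff)

lemma cscale_add: "cscale c (A + B) = cscale c A + cscale c B"
  by (simp add: vec_eq_iff algebra_simps)

lemma cscale_diff: "cscale c (A - B) = cscale c A - cscale c B"
  by (simp add: vec_eq_iff algebra_simps)

lemma cscale_1 [simp]: "cscale 1 A = A"
  by (simp add: vec_eq_iff)

lemma cscale_dg: "cscale c (dg f) = dg (\<lambda>i. c * f i)"
  by (simp add: vec_eq_iff dg_nth)

lemma matrix_mult_diff_left: "(A - B) ** C = A ** C - B ** (C :: 'n::finite cmat)"
  by (simp add: vec_eq_iff mult_nth sum_subtractf algebra_simps)

lemma matrix_mult_diff_right: "C ** (A - B) = C ** A - C ** (B :: 'n::finite cmat)"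
  by (simp add: vec_eq_iff mult_nth sum_subtractf algebra_simps)

lemma matrix_mult_add_left: "(A + B) ** C = A ** C + B ** (C :: 'n::finite cmat)"
  by (simp add: vec_eq_iff mult_nth sum.distrib algebra_simps)

lemma matrix_mult_add_right: "C ** (A + B) = C ** A + C ** (B :: 'n::finite cmat)"
  by (simp add: vec_eq_iff mult_nth sum.distrib algebra_simps)

lemma unitary_iff: "U \<in> unitary_group \<longleftrightarrow> U ** U\<^sup>\<dagger> = mat 1 \<and> U\<^sup>\<dagger> ** U = mat 1"
  by (simp add: unitary_group_def)

lemma unitary_cancel:
  assumes "U \<in> unitary_group"
  shows "U ** U\<^sup>\<dagger> = mat 1" "U\<^sup>\<dagger> ** U = mat 1" "A ** U ** U\<^sup>\<dagger> = A" "A ** U\<^sup>\<dagger> ** U = A"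
  using assms by (simp_all add: unitary_iff flip: matrix_mul_assoc)

lemma unitary_conj_transpose: "U \<in> unitary_group \<Longrightarrow> U\<^sup>\<dagger> \<in> unitary_group"
  by (simp add: unitary_iff)

lemma unitary_mult: "U \<in> unitary_group \<Longrightarrow> W \<in> unitary_group \<Longrightarrow> U ** W \<in> unitary_group"
  unfolding unitary_iff[of "U ** W"] by (simp add: conj_transpose_mult matrix_mul_assoc unitary_cancel)

lemma unitary_matrix_inv:
  assumes "U \<in> unitary_group"
  shows "matrix_inv U = U\<^sup>\<dagger>"
proof -
  have "invertible U"
    using assms unfolding invertible_def unitary_iff by blast
  then have "U ** matrix_inv U = mat 1"
    unfolding invertible_def matrix_inv_def by (metis (mono_tags, lifting) someI_ex)
  then have "U\<^sup>\<dagger> ** U ** matrix_inv U = U\<^sup>\<dagger>"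
    by (simp flip: matrix_mul_assoc)
  then show ?thesis
    using assms by (simp add: unitary_cancel)
qed

lemma inner_matrix: "(A :: 'n::finite cmat) \<bullet> B = (\<Sum>i\<in>UNIV. \<Sum>j\<in>UNIV. Re (A $ i $ j * cnj (B $ i $ j)))"
  by (simp add: inner_vec_def inner_complex_def)

lemma inner_eq_trace: "(A :: 'n::finite cmat) \<bullet> B = Re (trace (A ** B\<^sup>\<dagger>))"
  by (simp only: inner_matrix trace_def mult_nth conj_transpose_nth Re_sum)

lemma inner_mult_left: "((A :: 'n::finite cmat) ** B) \<bullet> (C :: 'n cmat) = B \<bullet> (A\<^sup>\<dagger> ** C)"
proof -
  have "trace (A ** B ** C\<^sup>\<dagger>) = trace (B ** C\<^sup>\<dagger> ** A)"
    by (metis matrix_mul_assoc trace_mul_sym)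
  then show ?thesis
    by (simp add: inner_eq_trace conj_transpose_mult matrix_mul_assoc)
qed

lemma inner_mult_right: "((A :: 'n::finite cmat) ** B) \<bullet> (C :: 'n cmat) = A \<bullet> (C ** B\<^sup>\<dagger>)"
  by (simp add: inner_eq_trace conj_transpose_mult matrix_mul_assoc)

lemma inner_cj:
  assumes "U \<in> unitary_group"
  shows "cj U A \<bullet> cj U B = A \<bullet> B"
proof -
  have "cj U A \<bullet> cj U B = (U ** (A ** U\<^sup>\<dagger>)) \<bullet> (U ** (B ** U\<^sup>\<dagger>))"
    by (simp add: cj_def matrix_mul_assoc)
  also have "\<dots> = (A ** U\<^sup>\<dagger>) \<bullet> (B ** U\<^sup>\<dagger>)"
    using assms by (subst inner_mult_left) (simp add: matrix_mul_assoc unitary_cancel)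
  also have "\<dots> = A \<bullet> B"
    using assms by (subst inner_mult_right) (simp add: unitary_cancel)
  finally show ?thesis .
qed

lemma norm_unitary_mult:
  assumes "U \<in> unitary_group"
  shows "norm (U ** A) = norm (A :: 'n::finite cmat)"
  using assms inner_mult_left[of U A "U ** A"]
  by (simp add: norm_eq_sqrt_inner matrix_mul_assoc unitary_cancel)

lemma norm_mult_unitary:
  assumes "U \<in> unitary_group"
  shows "norm (A ** U) = norm (A :: 'n::finite cmat)"
  using assms inner_mult_right[of A U "A ** U"]
  by (simp add: norm_eq_sqrt_inner unitary_cancel)

lemma norm_cj: "U \<in> unitary_group \<Longrightarrow> norm (cj U A) = norm A"
  by (simp add: cj_def norm_unitary_mult norm_mult_unitary unitary_conj_transpose)

lemma cj_mult: "U \<in> unitary_group \<Longrightarrow> cj U A ** cj U B = cj U (A ** B)"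
  by (simp add: cj_def matrix_mul_assoc unitary_cancel)

lemma cj_conj_transpose: "(cj U A)\<^sup>\<dagger> = cj U (A\<^sup>\<dagger>)"
  by (simp add: cj_def conj_transpose_mult matrix_mul_assoc)

lemma cj_add: "cj U (A + B) = cj U A + cj U B"
  by (simp add: cj_def matrix_mult_add_left matrix_mult_add_right)

lemma cj_diff: "cj U (A - B) = cj U A - cj U B"
  by (simp add: cj_def matrix_mult_diff_left matrix_mult_diff_right)

lemma cj_cscale: "cj U (cscale c A) = cscale c (cj U A)"
  by (simp add: cj_def cscale_mult_left cscale_mult_right)

lemma cj_scaleR: "cj U (r *\<^sub>R A) = r *\<^sub>R cj U A"
  by (simp add: scaleR_eq_cscale cj_cscale)

lemma cj_mat_1: "U \<in> unitary_group \<Longrightarrow> cj U (mat 1) = mat 1"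
  by (simp add: cj_def unitary_cancel)

lemma cj_cj: "cj U (cj W A) = cj (U ** W) A"
  by (simp add: cj_def conj_transpose_mult matrix_mul_assoc)

lemma cj_inverse:
  "U \<in> unitary_group \<Longrightarrow> cj U (cj (U\<^sup>\<dagger>) A) = A" "U \<in> unitary_group \<Longrightarrow> cj (U\<^sup>\<dagger>) (cj U A) = A"
  by (simp_all add: cj_cj unitary_cancel) (simp_all add: cj_def)

lemma cj_0 [simp]: "cj U 0 = 0"
  by (simp add: cj_def vec_eq_iff mult_nth)

lemma cj_sum: "cj U (\<Sum>k\<in>I. f k) = (\<Sum>k\<in>I. cj U (f k))"
  by (induction I rule: infinite_finite_induct) (simp_all add: cj_add)

section \<open>Continuity of the matrix operations, compactness of the unitary group\<close>

lemma bounded_bilinear_matrix_mult: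
  "bounded_bilinear ((**) :: 'n::finite cmat \<Rightarrow> 'n cmat \<Rightarrow> 'n cmat)"
proof -
  have "bilinear ((**) :: 'n::finite cmat \<Rightarrow> 'n cmat \<Rightarrow> 'n cmat)"
    unfolding bilinear_def
    by (auto intro!: linearI simp: matrix_mult_add_left matrix_mult_add_right scaleR_eq_cscale
        cscale_mult_left cscale_mult_right)
  then show ?thesis
    by (simp add: bilinear_conv_bounded_bilinear)
qed

lemmas continuous_on_matrix_mult [continuous_intros] =
  bounded_bilinear.continuous_on[OF bounded_bilinear_matrix_mult]

lemmas tendsto_matrix_mult [tendsto_intros] =
  bounded_bilinear.tendsto[OF bounded_bilinear_matrix_mult]

lemma linear_conj_transpose: "linear (conj_transpose :: 'n::finite cmat \<Rightarrow> 'n cmat)"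
  by (rule linearI) (simp_all add: conj_transpose_add conj_transpose_scaleR)

lemma continuous_on_conj_transpose [continuous_intros]:
  "continuous_on A f \<Longrightarrow> continuous_on A (\<lambda>x. (f x :: 'n::finite cmat)\<^sup>\<dagger>)"
  by (rule bounded_linear.continuous_on[OF linear_conv_bounded_linear[THEN iffD1, OF linear_conj_transpose]])

lemma tendsto_conj_transpose [tendsto_intros]:
  "(f \<longlongrightarrow> L) F \<Longrightarrow> ((\<lambda>x. (f x :: 'n::finite cmat)\<^sup>\<dagger>) \<longlongrightarrow> L\<^sup>\<dagger>) F"
  by (rule bounded_linear.tendsto[OF linear_conv_bounded_linear[THEN iffD1, OF linear_conj_transpose]])

lemma linear_cscale: "linear (cscale c :: 'n::finite cmat \<Rightarrow> 'n cmat)"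
  by (rule linearI) (simp_all add: cscale_add scaleR_eq_cscale mult.commute)

lemma compact_unitary_group: "compact (unitary_group :: 'n::finite cmat set)"
proof -
  have "bounded (unitary_group :: 'n cmat set)"
    unfolding bounded_iff
    using norm_unitary_mult[where A = "mat 1 :: 'n cmat"] by (intro exI[of _ "norm (mat 1 :: 'n cmat)"]) simp
  moreover have "closed ({g :: 'n cmat. g ** g\<^sup>\<dagger> = mat 1} \<inter> {g. g\<^sup>\<dagger> ** g = mat 1})"
    by (intro closed_Int closed_Collect_eq continuous_intros)
  moreover have "{g :: 'n cmat. g ** g\<^sup>\<dagger> = mat 1} \<inter> {g. g\<^sup>\<dagger> ** g = mat 1} = unitary_group"
    by (auto simp: unitary_iff)
  ultimately show ?thesis
    by (simp add: compact_eq_bounded_closed)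
qed

section \<open>The gradient of the trace function\<close>

text \<open>Functions of \<open>ad L\<close> for \<open>L\<close> diagonalized by \<open>U\<close> act in this way.\<close>

definition schur_mult :: "'n::finite cmat \<Rightarrow> ('n \<Rightarrow> 'n \<Rightarrow> complex) \<Rightarrow> 'n cmat \<Rightarrow> 'n cmat" where
  "schur_mult U f X = cj U (\<chi> i j. f i j * cj (U\<^sup>\<dagger>) X $ i $ j)"

lemma schur_mult_cong:
  "(\<And>i j. f i j = h i j) \<Longrightarrow> schur_mult U f X = schur_mult U h X"
  by (simp add: schur_mult_def)

lemma schur_mult_schur_mult:
  assumes "U \<in> unitary_group"
  shows "schur_mult U f (schur_mult U h X) = schur_mult U (\<lambda>i j. f i j * h i j) X"
  using assms by (simp add: schur_mult_def cj_inverse mult.assoc)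

lemma schur_mult_1:
  assumes "U \<in> unitary_group"
  shows "schur_mult U (\<lambda>_ _. 1) X = X"
  using assms by (simp add: schur_mult_def cj_inverse)

lemma schur_mult_add: "schur_mult U f (X + Y) = schur_mult U f X + schur_mult U f Y"
  unfolding schur_mult_def cj_add[symmetric]
  by (rule arg_cong[where f = "cj U"]) (simp add: vec_eq_iff cj_add algebra_simps)

lemma schur_mult_diff: "schur_mult U f (X - Y) = schur_mult U f X - schur_mult U f Y"
  unfolding schur_mult_def cj_diff[symmetric]
  by (rule arg_cong[where f = "cj U"]) (simp add: vec_eq_iff cj_diff algebra_simps)

lemma schur_mult_cscale: "cscale c (schur_mult U f X) = schur_mult U (\<lambda>i j. c * f i j) X"
  unfolding schur_mult_def cj_cscale[symmetric]
  by (rule arg_cong[where f = "cj U"]) (simp add: vec_eq_iff)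

lemma schur_mult_scaleR: "r *\<^sub>R schur_mult U f X = schur_mult U (\<lambda>i j. of_real r * f i j) X"
  by (simp add: scaleR_eq_cscale schur_mult_cscale)

lemma schur_mult_of_scaleR: "schur_mult U f (r *\<^sub>R X) = r *\<^sub>R schur_mult U f X"
  unfolding schur_mult_def cj_scaleR[symmetric]
  by (rule arg_cong[where f = "cj U"]) (simp add: vec_eq_iff cj_scaleR)

lemma schur_mult_sum: "schur_mult U (\<lambda>i j. \<Sum>k\<in>I. f k i j) X = (\<Sum>k\<in>I. schur_mult U (f k) X)"
  unfolding schur_mult_def cj_sum[symmetric]
  by (rule arg_cong[where f = "cj U"]) (simp add: vec_eq_iff sum_distrib_right)

lemma linear_schur_mult: "linear (schur_mult U f)"
  by (rule linearI) (simp_all add: schur_mult_add schur_mult_of_scaleR)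

lemma schur_mult_conj_transpose:
  "(schur_mult U f X)\<^sup>\<dagger> = schur_mult U (\<lambda>i j. cnj (f j i)) (X\<^sup>\<dagger>)"
  unfolding schur_mult_def cj_conj_transpose
  by (rule arg_cong[where f = "cj U"]) (simp add: vec_eq_iff flip: cj_conj_transpose)

lemma schur_mult_minus: "schur_mult U f (- X) = - schur_mult U f X"
  using linear_neg[OF linear_schur_mult] .

lemma inner_schur_mult:
  assumes "U \<in> unitary_group"
  shows "schur_mult U f X \<bullet> Y = X \<bullet> schur_mult U (\<lambda>i j. cnj (f i j)) Y"
proof -
  let ?X = "cj (U\<^sup>\<dagger>) X" and ?Y = "cj (U\<^sup>\<dagger>) Y"
  have "schur_mult U f X \<bullet> Y = schur_mult U f X \<bullet> cj U ?Y"
    using assms by (simp add: cj_inverse)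
  also have "\<dots> = (\<chi> i j. f i j * ?X $ i $ j) \<bullet> ?Y"
    using assms by (simp add: schur_mult_def inner_cj)
  also have "\<dots> = ?X \<bullet> (\<chi> i j. cnj (f i j) * ?Y $ i $ j)"
    unfolding inner_matrix by (simp add: mult_ac)
  also have "\<dots> = cj U ?X \<bullet> schur_mult U (\<lambda>i j. cnj (f i j)) Y"
    using assms by (simp only: schur_mult_def inner_cj)
  finally show ?thesis
    using assms by (simp add: cj_inverse)
qed

text \<open>Removes the product of traces from \<open>kappa\<close>, whose arguments will have zero
  diagonal in an eigenbasis of \<open>L\<close>.\<close>

lemma trace_schur_mult:
  assumes "U \<in> unitary_group" "\<And>i. f i i = 0"
  shows "trace (schur_mult U f X) = 0"
proof -
  have "trace (schur_mult U f X) = trace ((\<chi> i j. f i j * cj (U\<^sup>\<dagger>) X $ i $ j) ** U\<^sup>\<dagger> ** U)"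
    unfolding schur_mult_def cj_def[of U]
    using trace_mul_sym[of U "(\<chi> i j. f i j * cj (U\<^sup>\<dagger>) X $ i $ j) ** U\<^sup>\<dagger>"] by (simp add: matrix_mul_assoc)
  also have "\<dots> = 0"
    using assms by (simp add: unitary_cancel trace_def)
  finally show ?thesis .
qed

section \<open>The adjoint action and the two metrics in an eigenbasis of \<open>L\<close>\<close>

definition orbit_pt :: "('n \<Rightarrow> real) \<Rightarrow> 'n::finite cmat \<Rightarrow> 'n cmat" where
  "orbit_pt l U = cj U (dg (\<lambda>i. \<i> * of_real (l i)))"

lemma orbit_eq: "orbit lam = orbit_pt (\<lambda>i. lam (idx i)) ` unitary_group"
proof -
  have "cscale \<i> (Diag lam) = dg (\<lambda>i::'a. \<i> * of_real (lam (idx i)))"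
    by (simp add: vec_eq_iff Diag_def dg_nth)
  moreover have "U ** A ** matrix_inv U = cj U A" if "U \<in> unitary_group" for U A :: "'a cmat"
    using that by (simp add: cj_def unitary_matrix_inv)
  moreover have "orbit lam = (\<lambda>g. g ** cscale \<i> (Diag lam :: 'a cmat) ** matrix_inv g) ` unitary_group"
    unfolding orbit_def by blast
  ultimately show ?thesis
    by (simp add: orbit_pt_def cong: image_cong)
qed

lemma ad_orbit_pt:
  assumes "U \<in> unitary_group"
  shows "ad (orbit_pt l U) X = schur_mult U (\<lambda>i j. \<i> * of_real (l i - l j)) X"
proof -
  let ?d = "dg (\<lambda>i. \<i> * of_real (l i))"
  have "ad (orbit_pt l U) X = ad (cj U ?d) (cj U (cj (U\<^sup>\<dagger>) X))"
    using assms by (simp add: orbit_pt_def cj_inverse)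
  also have "\<dots> = cj U (?d ** cj (U\<^sup>\<dagger>) X - cj (U\<^sup>\<dagger>) X ** ?d)"
    using assms by (simp add: ad_def cj_mult cj_diff)
  also have "?d ** cj (U\<^sup>\<dagger>) X - cj (U\<^sup>\<dagger>) X ** ?d
      = (\<chi> i j. \<i> * of_real (l i - l j) * cj (U\<^sup>\<dagger>) X $ i $ j)"
    by (simp add: vec_eq_iff algebra_simps)
  finally show ?thesis
    by (simp add: schur_mult_def)
qed

lemma skew_herm_iff: "X \<in> skew_herm \<longleftrightarrow> X\<^sup>\<dagger> = - X"
  by (simp add: skew_herm_def)

lemma skew_herm_schur_mult:
  assumes "X \<in> skew_herm" "\<And>i j. cnj (f j i) = f i j"
  shows "schur_mult U f X \<in> skew_herm"
  using assms by (simp add: skew_herm_iff schur_mult_conj_transpose schur_mult_minus)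

lemma skew_herm_diff: "X \<in> skew_herm \<Longrightarrow> Y \<in> skew_herm \<Longrightarrow> X - Y \<in> skew_herm"
  by (simp add: skew_herm_iff conj_transpose_diff)

text \<open>The junk value \<open>1 / 0 = 0\<close> makes this the pseudo-inverse of \<open>ad (orbit_pt l U)\<close>.\<close>

definition ad_inv :: "('n \<Rightarrow> real) \<Rightarrow> 'n::finite cmat \<Rightarrow> 'n cmat \<Rightarrow> 'n cmat" where
  "ad_inv l U = schur_mult U (\<lambda>i j. - \<i> * of_real (1 / (l i - l j)))"

text \<open>\<open>ad_inv l U\<close> commutes with \<open>ad L\<close> and inverts it off the
  kernel, so the composite projects onto the image of \<open>ad L\<close>. As it depends on
  \<open>X\<close> only through \<open>ad L X\<close>, the choice of preimages in
  \<open>normal_metric\<close> does not matter.\<close>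

lemma im_part_orbit_pt:
  assumes U: "U \<in> unitary_group" and X: "X \<in> skew_herm"
  shows "im_part (orbit_pt l U) X = ad_inv l U (ad (orbit_pt l U) X)"
  unfolding im_part_def
proof (rule the_equality)
  let ?L = "orbit_pt l U"
  have comm: "ad_inv l U (ad ?L Y) = ad ?L (ad_inv l U Y)" for Y
    using U by (simp add: ad_inv_def ad_orbit_pt schur_mult_schur_mult mult_ac)
  have proj: "ad ?L (ad_inv l U (ad ?L Y)) = ad ?L Y" for Y
    unfolding ad_inv_def ad_orbit_pt[OF U] schur_mult_schur_mult[OF U]
    by (rule schur_mult_cong) (use right_inverse in \<open>auto simp: field_simps simp flip: of_real_diff of_real_mult of_real_divide\<close>)
  have inv_skew: "ad_inv l U Y \<in> skew_herm" if "Y \<in> skew_herm" for Y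
    unfolding ad_inv_def using that
    by (rule skew_herm_schur_mult) (auto simp: divide_simps complex_eq_iff)
  have "ad ?L X \<in> skew_herm"
    unfolding ad_orbit_pt[OF U] using X by (rule skew_herm_schur_mult) (simp add: algebra_simps)
  moreover have "ad_inv l U (ad ?L X) \<in> im_ad ?L"
    unfolding comm im_ad_def using inv_skew[OF X] by simp
  moreover have "ad_inv l U (ad ?L X) \<in> skew_herm"
    using inv_skew calculation(1) .
  then have "X - ad_inv l U (ad ?L X) \<in> skew_herm"
    using X skew_herm_diff by blast
  moreover have "ad ?L (X - ad_inv l U (ad ?L X)) = 0"
    using proj[of X] U by (simp add: ad_orbit_pt schur_mult_diff)
  ultimately show "ad_inv l U (ad ?L X) \<in> im_ad ?L \<and> X - ad_inv l U (ad ?L X) \<in> ker_ad ?L"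
    by (simp add: ker_ad_def)
  fix A assume A: "A \<in> im_ad ?L \<and> X - A \<in> ker_ad ?L"
  then obtain Y where Y: "A = ad ?L Y"
    by (auto simp: im_ad_def)
  have "ad ?L A = ad ?L X"
    using A U by (simp add: ker_ad_def ad_orbit_pt schur_mult_diff)
  then show "A = ad_inv l U (ad ?L X)"
    using comm proj Y by metis
qed

lemma norm_zero_of_inner_skew:
  assumes "A \<in> skew_herm" "\<And>Y. Y \<in> skew_herm \<Longrightarrow> A \<bullet> Y = 0"
  shows "A = 0"
  using assms by fastforce

text \<open>\<open>\<pi>\<close> is the orthogonal projection onto the image of \<open>ad L\<close>;
  since it is self-adjoint and idempotent, one occurrence suffices. On skew-Hermitian matrices - Re
  tr(XY) is the library inner product, and 2n is what remains of \<open>kappa\<close>.\<close>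

lemma normal_metric_orbit_pt:
  fixes U :: "'n::finite cmat" and l :: "'n \<Rightarrow> real"
  assumes U: "U \<in> unitary_group" and X: "X \<in> skew_herm" and Y: "Y \<in> skew_herm"
  defines "\<pi> \<equiv> schur_mult U (\<lambda>i j. if l i = l j then 0 else 1)"
  shows "normal_metric (orbit_pt l U) (ad (orbit_pt l U) X) (ad (orbit_pt l U) Y)
    = 2 * CARD('n) * (\<pi> X \<bullet> Y)"
proof -
  let ?L = "orbit_pt l U"
  have im: "im_part ?L Z = \<pi> Z" if "Z \<in> skew_herm" for Z
    unfolding \<pi>_def im_part_orbit_pt[OF U that] ad_inv_def ad_orbit_pt[OF U] schur_mult_schur_mult[OF U]
    by (rule schur_mult_cong) (simp add: field_simps)
  have tr: "trace (\<pi> Z) = 0" for Z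
    unfolding \<pi>_def by (rule trace_schur_mult[OF U]) simp
  have "\<pi> Y \<in> skew_herm"
    unfolding \<pi>_def using Y by (rule skew_herm_schur_mult) simp
  then have "\<pi> X \<bullet> \<pi> Y = - Re (trace (\<pi> X ** \<pi> Y))"
    by (simp add: inner_eq_trace skew_herm_iff trace_def mult_nth sum_negf)
  moreover have "\<pi> X \<bullet> \<pi> Y = \<pi> X \<bullet> Y"
  proof -
    have "\<pi> X \<bullet> \<pi> Y = X \<bullet> \<pi> (\<pi> Y)"
      unfolding \<pi>_def by (subst inner_schur_mult[OF U]) (simp add: if_distrib[of cnj] cong: if_cong)
    also have "\<pi> (\<pi> Y) = \<pi> Y"
      unfolding \<pi>_def schur_mult_schur_mult[OF U] by (rule schur_mult_cong) simp
    also have "X \<bullet> \<pi> Y = \<pi> X \<bullet> Y"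
      unfolding \<pi>_def by (subst inner_schur_mult[OF U]) (simp add: if_distrib[of cnj] cong: if_cong)
    finally show ?thesis .
  qed
  ultimately have val: "- Re (kappa (im_part ?L X) (im_part ?L Y)) = 2 * CARD('n) * (\<pi> X \<bullet> Y)"
    using X Y by (simp add: kappa_def im tr)
  show ?thesis
    unfolding normal_metric_def
  proof (rule the_equality)
    show "\<exists>X'\<in>skew_herm. \<exists>Y'\<in>skew_herm. ad ?L X = ad ?L X' \<and> ad ?L Y = ad ?L Y' \<and>
        2 * CARD('n) * (\<pi> X \<bullet> Y) = - Re (kappa (im_part ?L X') (im_part ?L Y'))"
      using X Y val by metis
    fix r
    assume "\<exists>X'\<in>skew_herm. \<exists>Y'\<in>skew_herm. ad ?L X = ad ?L X' \<and> ad ?L Y = ad ?L Y' \<and>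
        r = - Re (kappa (im_part ?L X') (im_part ?L Y'))"
    then show "r = 2 * CARD('n) * (\<pi> X \<bullet> Y)"
      using X Y U val by (metis im_part_orbit_pt)
  qed
qed

text \<open>From (R + s)(R - s)x = 0 the vector y = (R - s)x satisfies R y = - s y. Positivity
  forces y = 0 if s > 0; for s = 0 symmetry gives y \<bullet> y = x \<bullet> R y = 0.\<close>

lemma psd_sqrt_eigenvector:
  assumes R: "psd_sqrt_on V T R" and V: "subspace V" and x: "x \<in> V"
    and s: "0 \<le> s" and T: "T x = s\<^sup>2 *\<^sub>R x"
  shows "R x = s *\<^sub>R x"
proof -
  have lin: "linear R" and maps: "\<And>y. y \<in> V \<Longrightarrow> R y \<in> V"
    and sym: "\<And>y z. y \<in> V \<Longrightarrow> z \<in> V \<Longrightarrow> R y \<bullet> z = y \<bullet> R z"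
    and pos: "\<And>y. y \<in> V \<Longrightarrow> 0 \<le> R y \<bullet> y" and sq: "R (R x) = s\<^sup>2 *\<^sub>R x"
    using R x T by (auto simp: psd_sqrt_on_def)
  define y where "y = R x - s *\<^sub>R x"
  have y: "y \<in> V"
    unfolding y_def using maps[OF x] x V by (simp add: subspace_diff subspace_scale)
  have Ry: "R y = - (s *\<^sub>R y)"
    unfolding y_def using sq
    by (simp add: linear_diff[OF lin] linear_scale[OF lin] algebra_simps power2_eq_square)
  have "y = 0"
  proof (cases "s = 0")
    case True
    have "y \<bullet> y = x \<bullet> R y"
      using sym[OF x maps[OF x]] True by (simp add: y_def)
    then show ?thesis
      using Ry True by simp
  next
    case False
    have "0 \<le> - (s * (y \<bullet> y))"
      using pos[OF y] by (simp add: Ry)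
    then have "y \<bullet> y \<le> 0"
      using s False by (simp add: mult_le_0_iff)
    then show ?thesis
      by (metis inner_gt_zero_iff not_less)
  qed
  then show ?thesis
    by (simp add: y_def)
qed

lemma sqrt_neg_ad_sq_orbit_pt:
  fixes U :: "'n::finite cmat"
  assumes U: "U \<in> unitary_group" and X: "X \<in> skew_herm"
  shows "sqrt_neg_ad_sq (orbit_pt l U) X = schur_mult U (\<lambda>i j. of_real \<bar>l i - l j\<bar>) X"
proof -
  let ?L = "orbit_pt l U"
  let ?T = "\<lambda>X. - ad ?L (ad ?L X)" and ?R = "schur_mult U (\<lambda>i j. of_real \<bar>l i - l j\<bar>)"
  have T: "?T Y = schur_mult U (\<lambda>i j. of_real ((l i - l j)\<^sup>2)) Y" for Y
  proof -
    have "?T Y = cscale (-1) (ad ?L (ad ?L Y))"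
      by (simp add: vec_eq_iff)
    also have "\<dots> = schur_mult U (\<lambda>i j. of_real ((l i - l j)\<^sup>2)) Y"
      using U by (simp add: ad_orbit_pt schur_mult_schur_mult schur_mult_cscale power2_eq_square algebra_simps)
    finally show ?thesis .
  qed
  have sub: "subspace (skew_herm :: 'n cmat set)"
    by (auto simp: subspace_def skew_herm_iff conj_transpose_add conj_transpose_scaleR vec_eq_iff)
  \<comment> \<open>As the square of a self-adjoint operator, \<open>?R\<close> is positive
    semidefinite.\<close>
  have half: "?R Y = schur_mult U (\<lambda>i j. of_real (sqrt \<bar>l i - l j\<bar>))
      (schur_mult U (\<lambda>i j. of_real (sqrt \<bar>l i - l j\<bar>)) Y)" for Y
    by (simp add: schur_mult_schur_mult[OF U] flip: of_real_mult)
  have psd: "psd_sqrt_on skew_herm ?T ?R"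
    unfolding psd_sqrt_on_def
  proof (intro conjI ballI)
    show "linear ?R"
      by (rule linear_schur_mult)
    show "?R ` skew_herm \<subseteq> skew_herm"
      by (auto intro!: skew_herm_schur_mult simp: abs_minus_commute)
    show "?R Y \<bullet> Z = Y \<bullet> ?R Z" for Y Z
      by (subst inner_schur_mult[OF U]) simp
    show "0 \<le> ?R Y \<bullet> Y" for Y
      unfolding half by (subst inner_schur_mult[OF U]) simp
    show "?R (?R Y) = ?T Y" for Y
      unfolding T by (simp add: schur_mult_schur_mult[OF U] power2_eq_square flip: of_real_mult)
  qed
  have uniq: "R X = ?R X" if R: "psd_sqrt_on skew_herm ?T R" for R
  proof -
    \<comment> \<open>\<open>I\<close> collects the eigenvalues s of \<open>?R\<close>, and
      \<open>E s\<close> is the component of \<open>X\<close> on which \<open>?T\<close> acts as s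
      squared. Every root acts as s on \<open>E s\<close>, hence is determined on \<open>X\<close>,
      the sum of these components.\<close>
    define I where "I = (\<lambda>(i, j). \<bar>l i - l j\<bar>) ` UNIV"
    have fin: "finite I"
      by (simp add: I_def)
    define E where "E s = schur_mult U (\<lambda>i j. if \<bar>l i - l j\<bar> = s then 1 else 0) X" for s
    have mem: "\<bar>l i - l j\<bar> \<in> I" for i j
      by (auto simp: I_def image_iff)
    have sumX: "X = (\<Sum>s\<in>I. E s)"
      unfolding E_def schur_mult_sum[symmetric]
      using mem fin by (simp add: schur_mult_1[OF U])
    have RE: "R' (E s) = s *\<^sub>R E s" if "s \<in> I" "psd_sqrt_on skew_herm ?T R'" for s R'
    proof (rule psd_sqrt_eigenvector[OF that(2) sub])
      show "E s \<in> skew_herm"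
        unfolding E_def using X by (rule skew_herm_schur_mult) (auto simp: abs_minus_commute)
      show "0 \<le> s"
        using that by (auto simp: I_def)
      show "?T (E s) = s\<^sup>2 *\<^sub>R E s"
        unfolding T E_def schur_mult_schur_mult[OF U] schur_mult_scaleR
        by (rule schur_mult_cong) (auto simp flip: of_real_power)
    qed
    have sumR: "R' X = (\<Sum>s\<in>I. s *\<^sub>R E s)" if "psd_sqrt_on skew_herm ?T R'" for R'
    proof -
      have "linear R'"
        using that by (simp add: psd_sqrt_on_def)
      then have "R' X = (\<Sum>s\<in>I. R' (E s))"
        by (subst sumX) (simp add: linear_sum)
      then show ?thesis
        using RE that by simp
    qed
    show ?thesis
      by (simp only: sumR[OF R] sumR[OF psd])
  qed
  show ?thesis
    unfolding sqrt_neg_ad_sq_def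
  proof (rule the_equality)
    show "\<exists>R. psd_sqrt_on skew_herm ?T R \<and> ?R X = R X"
      by (rule exI[of _ ?R]) (simp only: psd simp_thms)
    fix W assume "\<exists>R. psd_sqrt_on skew_herm ?T R \<and> W = R X"
    then obtain R where R: "psd_sqrt_on skew_herm ?T R" "W = R X"
      by (elim exE conjE)
    show "W = ?R X"
      unfolding R(2) by (rule uniq[OF R(1)])
  qed
qed

text \<open>The projection in \<open>normal_metric_orbit_pt\<close> is absorbed: the factor \<bar>l
  i - l j\<bar> already vanishes wherever the projection does.\<close>

lemma kahler_metric_orbit_pt:
  fixes U :: "'n::finite cmat"
  assumes U: "U \<in> unitary_group" and X: "X \<in> skew_herm" and Y: "Y \<in> skew_herm"
  shows "kahler_metric (orbit_pt l U) (ad (orbit_pt l U) X) (ad (orbit_pt l U) Y)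
    = 2 * CARD('n) * (schur_mult U (\<lambda>i j. of_real \<bar>l i - l j\<bar>) X \<bullet> Y)"
proof -
  let ?L = "orbit_pt l U" and ?R = "schur_mult U (\<lambda>i j. of_real \<bar>l i - l j\<bar>)"
  have "ad ?L X \<in> skew_herm"
    unfolding ad_orbit_pt[OF U] using X by (rule skew_herm_schur_mult) (simp add: algebra_simps)
  then have "sqrt_neg_ad_sq ?L (ad ?L X) = ?R (ad ?L X)"
    by (rule sqrt_neg_ad_sq_orbit_pt[OF U])
  also have "\<dots> = ad ?L (?R X)"
    using U by (simp add: ad_orbit_pt schur_mult_schur_mult mult_ac)
  finally have 1: "sqrt_neg_ad_sq ?L (ad ?L X) = ad ?L (?R X)" .
  have RX: "?R X \<in> skew_herm"
    using X by (rule skew_herm_schur_mult) (simp add: abs_minus_commute)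
  have "schur_mult U (\<lambda>i j. if l i = l j then 0 else 1) (?R X) = ?R X"
    unfolding schur_mult_schur_mult[OF U]
    by (rule schur_mult_cong) auto
  then show ?thesis
    unfolding kahler_metric_def 1 using normal_metric_orbit_pt[OF U RX Y, of l] by simp
qed

lemma linear_trace_fun: "linear (trace_fun N)"
  unfolding trace_fun_def
  by (rule linearI) (simp_all add: matrix_mult_add_left trace_add scaleR_eq_cscale cscale_mult_left,
    simp add: trace_def sum_distrib_left)

lemma frechet_derivative_trace_fun: "frechet_derivative (trace_fun N) (at L) = trace_fun N"
  by (rule frechet_derivative_at[symmetric])
     (simp add: bounded_linear_imp_has_derivative linear_trace_fun linear_linear)

lemma kahler_grad_trace_fun:
  fixes U :: "'n::finite cmat"
  assumes U: "U \<in> unitary_group" and N: "N \<in> skew_herm"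
  shows "kahler_grad (trace_fun N) (orbit_pt l U)
    = schur_mult U (\<lambda>i j. of_real (- \<bar>l i - l j\<bar> / (2 * CARD('n)))) N"
proof -
  let ?L = "orbit_pt l U" and ?R = "schur_mult U (\<lambda>i j. of_real \<bar>l i - l j\<bar>)"
  define c where "c = 2 * real CARD('n)"
  have c: "c > 0"
    by (simp add: c_def)
  \<comment> \<open>The entrywise solution of 2n \<bar>l i - l j\<bar> Z = \<i> (l i - l j) N, the
    equation that arises by comparing the metric with the differential
    \<open>ad ?L N \<bullet> Y\<close> of the trace function.\<close>
  define Z where "Z = schur_mult U (\<lambda>i j. \<i> * of_real (sgn (l i - l j) / c)) N"
  have Z: "Z \<in> skew_herm"
    unfolding Z_def using N by (rule skew_herm_schur_mult) (auto simp: sgn_if complex_eq_iff)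
  have adZ: "ad ?L Z = schur_mult U (\<lambda>i j. of_real (- \<bar>l i - l j\<bar> / c)) N"
    unfolding Z_def ad_orbit_pt[OF U] schur_mult_schur_mult[OF U]
    by (rule schur_mult_cong) (auto simp: complex_eq_iff sgn_if)
  have RZ: "c *\<^sub>R ?R Z = ad ?L N"
    unfolding Z_def ad_orbit_pt[OF U] schur_mult_schur_mult[OF U] schur_mult_scaleR
    using c by (intro schur_mult_cong) (auto simp: complex_eq_iff sgn_if)
  have der: "frechet_derivative (trace_fun N) (at ?L) (ad ?L Y) = ad ?L N \<bullet> Y" if "Y \<in> skew_herm" for Y
  proof -
    have "frechet_derivative (trace_fun N) (at ?L) (ad ?L Y) = - (ad ?L Y \<bullet> N)"
      using N by (simp add: frechet_derivative_trace_fun trace_fun_def inner_eq_trace skew_herm_iff)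
        (simp add: trace_def mult_nth sum_negf)
    also have "ad ?L Y \<bullet> N = Y \<bullet> schur_mult U (\<lambda>i j. cnj (\<i> * of_real (l i - l j))) N"
      unfolding ad_orbit_pt[OF U] by (rule inner_schur_mult[OF U])
    also have "schur_mult U (\<lambda>i j. cnj (\<i> * of_real (l i - l j))) N = (-1) *\<^sub>R ad ?L N"
      unfolding ad_orbit_pt[OF U] schur_mult_scaleR by (simp add: algebra_simps)
    finally show ?thesis
      by (simp add: inner_commute)
  qed
  have "kahler_grad (trace_fun N) ?L = ad ?L Z"
    unfolding kahler_grad_def
  proof (rule the_equality)
    show "ad ?L Z \<in> im_ad ?L \<and> (\<forall>V\<in>im_ad ?L. kahler_metric ?L (ad ?L Z) V
        = frechet_derivative (trace_fun N) (at ?L) V)"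
      using Z RZ der kahler_metric_orbit_pt[OF U Z]
      by (auto simp: im_ad_def c_def simp flip: inner_scaleR_left)
    fix G
    assume G: "G \<in> im_ad ?L \<and> (\<forall>V\<in>im_ad ?L. kahler_metric ?L G V
        = frechet_derivative (trace_fun N) (at ?L) V)"
    then obtain X where X: "X \<in> skew_herm" "G = ad ?L X"
      by (auto simp: im_ad_def)
    have "?R (X - Z) \<bullet> Y = 0" if "Y \<in> skew_herm" for Y
    proof -
      have "c * (?R X \<bullet> Y) = ad ?L N \<bullet> Y"
        using G X der[OF that] kahler_metric_orbit_pt[OF U X(1) that, of l] that
        by (auto simp: im_ad_def c_def)
      also have "\<dots> = c * (?R Z \<bullet> Y)"
        by (simp flip: RZ)
      finally show ?thesis
        using c by (simp add: schur_mult_diff inner_diff_left)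
    qed
    moreover have "?R (X - Z) \<in> skew_herm"
      using skew_herm_diff[OF X(1) Z] by (rule skew_herm_schur_mult) (simp add: abs_minus_commute)
    ultimately have "?R (X - Z) = 0"
      by (intro norm_zero_of_inner_skew)
    \<comment> \<open>Multiplication by \<i> sgn (l i - l j) turns the absolute values back into
      \<open>ad ?L\<close>, so \<open>X\<close> and \<open>Z\<close> have the same image under
      \<open>ad ?L\<close>.\<close>
    then have "schur_mult U (\<lambda>i j. \<i> * of_real (sgn (l i - l j))) (?R (X - Z)) = 0"
      by (simp add: linear_0[OF linear_schur_mult])
    then have "ad ?L (X - Z) = 0"
      unfolding schur_mult_schur_mult[OF U] ad_orbit_pt[OF U]
      by (simp add: mult.assoc sgn_mult_abs flip: of_real_mult)
    then show "G = ad ?L Z"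
      using X by (simp add: ad_orbit_pt[OF U] schur_mult_diff)
  qed
  then show ?thesis
    using adZ by (simp add: c_def)
qed

section \<open>The vector field along the orbit\<close>

lemma norm_le_entrywise:
  fixes A B :: "'n::finite cmat"
  assumes "\<And>i j. norm (A $ i $ j) \<le> norm (B $ i $ j)"
  shows "norm A \<le> norm B"
  unfolding norm_vec_def[of A] norm_vec_def[of B]
  by (rule L2_set_mono) (auto simp: norm_vec_def intro!: L2_set_mono assms)

text \<open>Multiplying by unitaries on both sides turns the difference into the commutator of
  \<open>dg f\<close> with \<open>U\<^sup>\<dagger> ** W\<close>, whose entries are those of
  \<open>U\<^sup>\<dagger> ** W\<close> times f i - f j. It bounds the motion of a spectral
  projection by the motion of the point of the orbit.\<close>

lemma norm_cj_dg_diff: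
  fixes U W :: "'n::finite cmat"
  assumes U: "U \<in> unitary_group" and W: "W \<in> unitary_group" and c: "0 \<le> c"
    and le: "\<And>i j. c * norm (d i - d j) \<le> norm (e i - e j)"
  shows "c * norm (cj U (dg d) - cj W (dg d)) \<le> norm (cj U (dg e) - cj W (dg e))"
proof -
  have eq: "norm (cj U (dg f) - cj W (dg f)) = norm (dg f ** (U\<^sup>\<dagger> ** W) - (U\<^sup>\<dagger> ** W) ** dg f)" for f
  proof -
    have "norm (cj U (dg f) - cj W (dg f)) = norm (U\<^sup>\<dagger> ** ((cj U (dg f) - cj W (dg f)) ** W))"
      using U W by (simp add: norm_unitary_mult norm_mult_unitary unitary_conj_transpose)
    also have "U\<^sup>\<dagger> ** ((cj U (dg f) - cj W (dg f)) ** W) = dg f ** (U\<^sup>\<dagger> ** W) - (U\<^sup>\<dagger> ** W) ** dg f"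
      using U W by (simp add: cj_def matrix_mult_diff_left matrix_mult_diff_right matrix_mul_assoc unitary_cancel)
    finally show ?thesis .
  qed
  let ?Z = "U\<^sup>\<dagger> ** W"
  have "norm (c *\<^sub>R (dg d ** ?Z - ?Z ** dg d)) \<le> norm (dg e ** ?Z - ?Z ** dg e)"
  proof (rule norm_le_entrywise)
    fix i j
    have comm: "(dg f ** ?Z - ?Z ** dg f) $ i $ j = (f i - f j) * ?Z $ i $ j" for f
      by (simp add: algebra_simps)
    show "norm ((c *\<^sub>R (dg d ** ?Z - ?Z ** dg d)) $ i $ j) \<le> norm ((dg e ** ?Z - ?Z ** dg e) $ i $ j)"
      using mult_right_mono[OF le[of i j] norm_ge_zero[of "?Z $ i $ j"]] c
      unfolding vector_scaleR_component comm by (simp add: norm_mult mult.assoc)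
  qed
  then show ?thesis
    using c by (simp add: eq)
qed

text \<open>Gronwall for the squared distance \<open>D\<close>, in both time directions. The field
  is controlled only on \<open>X\<close>, in practice the orbit, and both curves stay there.\<close>

lemma ode_unique:
  fixes L M :: "real \<Rightarrow> 'a::euclidean_space"
  assumes L: "\<And>t. (L has_vector_derivative F (L t)) (at t)" "\<And>t. L t \<in> X"
    and M: "\<And>t. (M has_vector_derivative F (M t)) (at t)" "\<And>t. M t \<in> X"
    and lip: "C-lipschitz_on X F" and T: "L T = M T"
  shows "L t = M t"
proof -
  define D where "D t = (L t - M t) \<bullet> (L t - M t)" for t
  define D' where "D' t = 2 * ((L t - M t) \<bullet> (F (L t) - F (M t)))" for t
  have D: "(D has_field_derivative D' t) (at t)" for t
    unfolding D_def D'_def has_real_derivative_iff_has_vector_derivative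
    using bounded_bilinear.has_vector_derivative[OF bounded_bilinear_inner
        has_vector_derivative_diff[OF L(1)[of t] M(1)[of t]] has_vector_derivative_diff[OF L(1)[of t] M(1)[of t]]]
    by (simp add: inner_commute)
  have bound: "\<bar>D' t\<bar> \<le> 2 * C * D t" for t
  proof -
    have "\<bar>(L t - M t) \<bullet> (F (L t) - F (M t))\<bar> \<le> norm (L t - M t) * norm (F (L t) - F (M t))"
      by (rule Cauchy_Schwarz_ineq2)
    also have "\<dots> \<le> norm (L t - M t) * (C * norm (L t - M t))"
      using lipschitz_onD[OF lip L(2)[of t] M(2)[of t]] by (intro mult_left_mono) (auto simp: dist_norm)
    also have "\<dots> = C * D t"
      by (simp add: D_def power2_norm_eq_inner[symmetric] power2_eq_square)
    finally show ?thesis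
      by (simp add: D'_def abs_mult)
  qed
  have D0: "D T = 0" and Dnn: "0 \<le> D t" for t
    using T by (simp_all add: D_def)
  have "D t \<le> 0"
  proof (cases "T \<le> t")
    case True
    have "exp (- 2 * C * t) * D t \<le> exp (- 2 * C * T) * D T"
    proof (rule DERIV_nonpos_imp_nonincreasing[OF True])
      fix x
      have "((\<lambda>t. exp (- 2 * C * t) * D t) has_field_derivative
          exp (- 2 * C * x) * (D' x - 2 * C * D x)) (at x)"
        by (auto intro!: derivative_eq_intros D simp: algebra_simps)
      moreover have "exp (- 2 * C * x) * (D' x - 2 * C * D x) \<le> 0"
        using bound[of x] by (intro mult_nonneg_nonpos) auto
      ultimately show "\<exists>y. ((\<lambda>t. exp (- 2 * C * t) * D t) has_field_derivative y) (at x) \<and> y \<le> 0"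
        by blast
    qed
    then show ?thesis
      by (simp add: D0 mult_le_0_iff)
  next
    case False
    then have "t \<le> T" by simp
    then have "exp (2 * C * t) * D t \<le> exp (2 * C * T) * D T"
    proof (rule DERIV_nonneg_imp_nondecreasing)
      fix x
      have "((\<lambda>t. exp (2 * C * t) * D t) has_field_derivative
          exp (2 * C * x) * (D' x + 2 * C * D x)) (at x)"
        by (auto intro!: derivative_eq_intros D simp: algebra_simps)
      moreover have "exp (2 * C * x) * (D' x + 2 * C * D x) \<ge> 0"
        using bound[of x] by (intro mult_nonneg_nonneg) auto
      ultimately show "\<exists>y. ((\<lambda>t. exp (2 * C * t) * D t) has_field_derivative y) (at x) \<and> 0 \<le> y"
        by blast
    qed
    then show ?thesis
      by (simp add: D0 mult_le_0_iff)
  qed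
  then have "D t = 0"
    using Dnn[of t] by simp
  then show ?thesis
    by (simp add: D_def)
qed

section \<open>Positions of indices, and the field as a sum over spectral projections\<close>

lemma idx_strict_mono: "i < j \<Longrightarrow> idx i < idx (j :: 'n::{finite, linorder})"
  unfolding idx_def by (rule psubset_card_mono) (auto simp: psubset_eq set_eq_iff intro!: exI[of _ j])

lemma idx_less_iff [simp]: "idx i < idx j \<longleftrightarrow> i < (j :: 'n::{finite, linorder})"
  using idx_strict_mono[of i j] idx_strict_mono[of j i] by (cases i j rule: linorder_cases) auto

lemma idx_eq_iff [simp]: "idx i = idx j \<longleftrightarrow> i = (j :: 'n::{finite, linorder})"
  using idx_less_iff[of i j] idx_less_iff[of j i] by (cases i j rule: linorder_cases) (auto simp del: idx_less_iff)

lemma idx_bounds: "1 \<le> idx i" "idx (i :: 'n::{finite, linorder}) \<le> CARD('n)"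
proof -
  have "card {j. j \<le> i} > 0"
    by (subst card_gt_0_iff) auto
  then show "1 \<le> idx i"
    by (simp add: idx_def)
  show "idx i \<le> CARD('n)"
    unfolding idx_def by (rule card_mono) auto
qed

lemma idx_mem: "idx (i :: 'n::{finite, linorder}) \<in> {1..CARD('n)}"
  using idx_bounds[of i] by simp

lemma telescope_from:
  fixes f :: "nat \<Rightarrow> real"
  assumes "i \<in> {1..n}"
  shows "f i = f n + (\<Sum>k\<in>{1..<n}. (f k - f (k + 1)) * (if i \<le> k then 1 else 0))"
proof -
  have "(\<Sum>k\<in>{1..<n}. (f k - f (k + 1)) * (if i \<le> k then 1 else 0)) = (\<Sum>k\<in>{i..<n}. f k - f (Suc k))"
    using assms by (intro sum.mono_neutral_cong_right) auto
  also have "\<dots> = f i - f n"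
    using assms sum_Suc_diff'[of i n "\<lambda>k. - f k"] by (simp add: algebra_simps)
  finally show ?thesis
    by simp
qed

text \<open>A diagonalizing \<open>g\<close> is fixed once and for all: its column at index i is an
  eigenvector of \<i>N for the eigenvalue \<open>mu (idx i)\<close>. It centres the chart.\<close>

locale gradient_setting =
  fixes lam mu :: "nat \<Rightarrow> real" and g N :: "'n::{finite, linorder} cmat"
  assumes lam_dec: "antimono_on {1..CARD('n)} lam"
    and mu_dec: "antimono_on {1..CARD('n)} mu"
    and gap: "\<And>k. k \<in> {1..<CARD('n)} \<Longrightarrow> lam k > lam (k + 1) \<Longrightarrow> mu k > mu (k + 1)"
    and N_skew: "N \<in> skew_herm"
    and g: "g \<in> unitary_group"
    and N_eq: "cscale \<i> N = cj g (dg (\<lambda>i. of_real (mu (idx i))))"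
begin

definition l :: "'n \<Rightarrow> real" where "l i = lam (idx i)"

definition a :: "'n \<Rightarrow> real" where "a i = mu (idx i) / (2 * CARD('n))"

definition w :: "nat \<Rightarrow> real" where "w k = lam k - lam (k + 1)"

text \<open>Conjugation by \<open>U\<close> makes this the orthogonal projection onto the span of
  the first \<open>k\<close> columns of \<open>U\<close>.\<close>

definition D :: "nat \<Rightarrow> 'n cmat" where "D k = dg (\<lambda>i. if idx i \<le> k then 1 else 0)"

definition A :: "'n cmat" where "A = cj g (dg (\<lambda>i. of_real (a i)))"

text \<open>The velocity at \<open>P\<close> of the orthogonal projection onto the image of the range of \<open>P\<close> under \<open>exp (t A)\<close>.\<close>

definition compress :: "'n cmat \<Rightarrow> 'n cmat" where
  "compress P = A ** P + P ** A - 2 *\<^sub>R (P ** A ** P)"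

lemma A_eq: "A = cscale (\<i> / (2 * CARD('n))) N"
proof -
  have "A = cscale (1 / (2 * CARD('n))) (cscale \<i> N)"
    unfolding N_eq A_def a_def cj_cscale[symmetric] cscale_dg by simp
  then show ?thesis
    by simp
qed

lemma l_antimono: "i \<le> j \<Longrightarrow> l j \<le> l i"
  unfolding l_def using lam_dec idx_mem[of i] idx_mem[of j] idx_less_iff[of j i]
  by (auto simp: monotone_on_def not_less simp del: idx_less_iff)

lemma w_nonneg: "k \<in> {1..<CARD('n)} \<Longrightarrow> 0 \<le> w k"
  using lam_dec by (auto simp: w_def monotone_on_def)

lemma l_telescope: "l i = lam CARD('n) + (\<Sum>k\<in>{1..<CARD('n)}. w k * (if idx i \<le> k then 1 else 0))"
  unfolding l_def w_def using idx_mem[of i] by (rule telescope_from)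

text \<open>A threshold k contributes its drop exactly when it separates the positions of i and j.
  This splits the factor \<bar>l i - l j\<bar> of the gradient into contributions of single
  projections.\<close>

lemma l_diff_abs:
  "\<bar>l i - l j\<bar> = (\<Sum>k\<in>{1..<CARD('n)}. w k * (if (idx i \<le> k) = (idx j \<le> k) then 0 else 1))"
proof (induction i j rule: linorder_wlog)
  case (le i j)
  then have ij: "idx i \<le> idx j"
    by (metis idx_less_iff leD linorder_le_less_linear)
  have "\<bar>l i - l j\<bar> = l i - l j"
    using l_antimono[OF le] by simp
  also have "\<dots> = (\<Sum>k\<in>{1..<CARD('n)}. w k * (if (idx i \<le> k) = (idx j \<le> k) then 0 else 1))"
    unfolding l_telescope[of i] l_telescope[of j] add_diff_cancel_left sum_subtractf[symmetric]
    using ij by (intro sum.cong) auto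
  finally show ?case .
next
  case (sym i j)
  then show ?case
    by (simp add: abs_minus_commute[of "l i"] eq_commute[of "idx i \<le> _"])
qed

lemma w_gap_le:
  assumes "k \<in> {1..<CARD('n)}" "(idx i \<le> k) \<noteq> (idx j \<le> k)"
  shows "w k \<le> \<bar>l i - l j\<bar>"
proof -
  have "w k * (if (idx i \<le> k) = (idx j \<le> k) then 0 else 1) \<le> \<bar>l i - l j\<bar>"
    unfolding l_diff_abs using assms w_nonneg by (intro member_le_sum) auto
  then show ?thesis
    using assms by simp
qed

lemma orbit_pt_eq_sum:
  assumes "U \<in> unitary_group"
  shows "orbit_pt l U = (\<Sum>k\<in>{1..<CARD('n)}. cscale (\<i> * of_real (w k)) (cj U (D k)))
    + cscale (\<i> * of_real (lam CARD('n))) (mat 1)"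
proof -
  have "dg (\<lambda>i. \<i> * of_real (l i)) = (\<Sum>k\<in>{1..<CARD('n)}. cscale (\<i> * of_real (w k)) (D k))
    + cscale (\<i> * of_real (lam CARD('n))) (mat 1)"
    unfolding vec_eq_iff
    by (subst l_telescope) (auto simp: dg_nth D_def mat_def sum_distrib_left algebra_simps
        intro!: sum.cong)
  then show ?thesis
    using assms by (simp add: orbit_pt_def cj_add cj_sum cj_cscale cj_mat_1)
qed

text \<open>In the eigenbasis the coefficient is p i + p j - 2 p i p j with p the 0-1 diagonal of
  \<open>D k\<close>: it keeps the two off-diagonal blocks of \<open>A\<close> and kills the
  diagonal ones.\<close>

lemma compress_cj:
  assumes U: "U \<in> unitary_group"
  shows "compress (cj U (D k)) = schur_mult U (\<lambda>i j. if (idx i \<le> k) = (idx j \<le> k) then 0 else 1) A"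
proof -
  let ?B = "cj (U\<^sup>\<dagger>) A"
  have "compress (cj U (D k)) = cj U (?B ** D k + D k ** ?B - 2 *\<^sub>R (D k ** ?B ** D k))"
    unfolding compress_def
    using U cj_inverse(1)[OF U, of A]
    by (simp add: cj_add cj_diff cj_scaleR flip: cj_mult)
  also have "?B ** D k + D k ** ?B - 2 *\<^sub>R (D k ** ?B ** D k)
      = (\<chi> i j. (if (idx i \<le> k) = (idx j \<le> k) then 0 else 1) * ?B $ i $ j)"
    by (auto simp: vec_eq_iff D_def scaleR_conv_of_real)
  finally show ?thesis
    by (simp add: schur_mult_def)
qed

text \<open>Compared term by term with \<open>orbit_pt_eq_sum\<close>, this prescribes the velocity
  \<open>compress\<close> for each spectral projection.\<close>

lemma kahler_grad_eq:
  assumes U: "U \<in> unitary_group"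
  shows "kahler_grad (trace_fun N) (orbit_pt l U)
    = (\<Sum>k\<in>{1..<CARD('n)}. cscale (\<i> * of_real (w k)) (compress (cj U (D k))))"
proof -
  have N: "N = cscale (- \<i> * (2 * CARD('n))) A"
    by (simp add: A_eq)
  have "kahler_grad (trace_fun N) (orbit_pt l U) = schur_mult U (\<lambda>i j. \<i> * of_real \<bar>l i - l j\<bar>) A"
    unfolding kahler_grad_trace_fun[OF U N_skew]
    by (subst N) (simp add: schur_mult_def cj_cscale mult_ac)
  also have "\<dots> = (\<Sum>k\<in>{1..<CARD('n)}. schur_mult U
      (\<lambda>i j. \<i> * of_real (w k) * (if (idx i \<le> k) = (idx j \<le> k) then 0 else 1)) A)"
    unfolding l_diff_abs schur_mult_sum[symmetric] of_real_sum sum_distrib_left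
    by (intro schur_mult_cong sum.cong) auto
  finally show ?thesis
    by (simp add: compress_cj[OF U] schur_mult_cscale)
qed

text \<open>Without the factor \<open>w k\<close> no such bound can hold: at a vanishing drop the
  projection is not determined by the point of the orbit.\<close>

lemma norm_cj_D_diff:
  assumes U: "U \<in> unitary_group" "W \<in> unitary_group" and k: "k \<in> {1..<CARD('n)}"
  shows "w k * norm (cj U (D k) - cj W (D k)) \<le> norm (orbit_pt l U - orbit_pt l W)"
  unfolding D_def orbit_pt_def
proof (rule norm_cj_dg_diff[OF U w_nonneg[OF k]])
  fix i j
  show "w k * cmod ((if idx i \<le> k then 1 else 0) - (if idx j \<le> k then 1 else 0))
      \<le> cmod (\<i> * of_real (l i) - \<i> * of_real (l j))"
    using w_gap_le[OF k, of i j]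
    by (auto simp: norm_mult simp flip: right_diff_distrib of_real_diff)
qed

lemma orbit_lam: "(orbit lam :: 'n cmat set) = orbit_pt l ` unitary_group"
  unfolding orbit_eq l_def[abs_def] by (rule refl)

text \<open>\<open>compress\<close> is quadratic, hence Lipschitz on matrices of bounded norm, and
  all conjugates of \<open>D k\<close> have the norm of \<open>D k\<close>. The weight
  \<open>w k\<close> pays for passing from projections to points via
  \<open>norm_cj_D_diff\<close>.\<close>

lemma lipschitz_kahler_grad: "\<exists>C. C-lipschitz_on (orbit lam :: 'n cmat set) (kahler_grad (trace_fun N))"
proof -
  obtain K where K0: "0 < K" "\<forall>(X :: 'n cmat) (Y :: 'n cmat). norm (X ** Y) \<le> norm X * norm Y * K"
    using bounded_bilinear.pos_bounded[OF bounded_bilinear_matrix_mult] by (elim exE conjE)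
  note K = K0(1) K0(2)[rule_format]
  \<comment> \<open>The first summand bounds the change of AP + PA, the second that of 2 PAP, using
    PAP - QAQ = (P - Q)AP + QA(P - Q).\<close>
  define b where "b k = 2 * norm A * K + 4 * norm (D k) * norm A * K * K" for k
  have b0: "0 \<le> b k" for k
    unfolding b_def using K by simp
  have comp: "norm (compress P - compress Q) \<le> b k * norm (P - Q)"
    if P: "norm P = norm (D k)" and Q: "norm Q = norm (D k)" for P Q k
  proof -
    have "compress P - compress Q = A ** (P - Q) + (P - Q) ** A
        - 2 *\<^sub>R ((P - Q) ** A ** P + Q ** A ** (P - Q))"
      by (simp add: compress_def matrix_mult_diff_left matrix_mult_diff_right algebra_simps)
    then have h0: "norm (compress P - compress Q) \<le> norm (A ** (P - Q)) + norm ((P - Q) ** A)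
        + 2 * (norm ((P - Q) ** A ** P) + norm (Q ** A ** (P - Q)))"
      using norm_triangle_ineq4[of "A ** (P - Q) + (P - Q) ** A" "2 *\<^sub>R ((P - Q) ** A ** P + Q ** A ** (P - Q))"]
        norm_triangle_ineq[of "A ** (P - Q)" "(P - Q) ** A"]
        norm_triangle_ineq[of "(P - Q) ** A ** P" "Q ** A ** (P - Q)"] by simp
    have h1: "norm ((P - Q) ** A ** P) \<le> (norm (P - Q) * norm A * K) * norm P * K"
      using K(2)[of "(P - Q) ** A" P] mult_right_mono[OF K(2)[of "P - Q" A], of "norm P * K"] K(1)
      by (simp add: mult.assoc)
    have h2: "norm (Q ** A ** (P - Q)) \<le> (norm Q * norm A * K) * norm (P - Q) * K"
      using K(2)[of "Q ** A" "P - Q"] mult_right_mono[OF K(2)[of Q A], of "norm (P - Q) * K"] K(1)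
      by (simp add: mult.assoc)
    have "norm (compress P - compress Q) \<le> norm A * norm (P - Q) * K + norm (P - Q) * norm A * K
        + 2 * ((norm (P - Q) * norm A * K) * norm P * K + (norm Q * norm A * K) * norm (P - Q) * K)"
      by (rule order_trans[OF h0]) (intro add_mono mult_left_mono h1 h2 K(2), simp)
    also have "\<dots> = b k * norm (P - Q)"
      by (simp add: b_def P Q algebra_simps)
    finally show ?thesis .
  qed
  define C where "C = (\<Sum>k\<in>{1..<CARD('n)}. b k)"
  have "C-lipschitz_on (orbit lam :: 'n cmat set) (kahler_grad (trace_fun N))"
  proof (rule lipschitz_onI)
    show "0 \<le> C"
      unfolding C_def by (intro sum_nonneg b0)
    fix x y :: "'n cmat" assume "x \<in> orbit lam" "y \<in> orbit lam"
    then obtain U W where U: "U \<in> unitary_group" "x = orbit_pt l U" and W: "W \<in> unitary_group" "y = orbit_pt l W"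
      unfolding orbit_lam by (elim imageE)
    have "kahler_grad (trace_fun N) x - kahler_grad (trace_fun N) y = (\<Sum>k\<in>{1..<CARD('n)}.
        cscale (\<i> * of_real (w k)) (compress (cj U (D k)) - compress (cj W (D k))))"
      by (simp add: U W kahler_grad_eq sum_subtractf cscale_diff)
    also have "norm \<dots> \<le> (\<Sum>k\<in>{1..<CARD('n)}. b k * norm (x - y))"
    proof (rule sum_norm_le)
      fix k assume k: "k \<in> {1..<CARD('n)}"
      let ?X = "compress (cj U (D k)) - compress (cj W (D k))"
      have "norm (cscale (\<i> * of_real (w k)) ?X) \<le> norm (w k *\<^sub>R ?X)"
        by (rule norm_le_entrywise) (simp add: norm_mult)
      also have "\<dots> = w k * norm ?X"
        using w_nonneg[OF k] by simp
      also have "\<dots> \<le> w k * (b k * norm (cj U (D k) - cj W (D k)))"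
        using w_nonneg[OF k] U W by (intro mult_left_mono comp) (simp_all add: norm_cj)
      also have "\<dots> = b k * (w k * norm (cj U (D k) - cj W (D k)))"
        by (simp add: mult_ac)
      also have "\<dots> \<le> b k * norm (x - y)"
        unfolding U W using norm_cj_D_diff[OF U(1) W(1) k] b0 by (intro mult_left_mono)
      finally show "norm (cscale (\<i> * of_real (w k)) ?X) \<le> b k * norm (x - y)" .
    qed
    also have "\<dots> = C * norm (x - y)"
      by (simp add: C_def sum_distrib_right)
    finally show "dist (kahler_grad (trace_fun N) x) (kahler_grad (trace_fun N) y) \<le> C * dist x y"
      by (simp add: dist_norm)
  qed
  then show ?thesis ..
qed

lemma kahler_flow_unique:
  assumes "kahler_flow lam (trace_fun N) L" "kahler_flow lam (trace_fun N) M" "L T = M T"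
  shows "L t = M t"
proof -
  obtain C where "C-lipschitz_on (orbit lam :: 'n cmat set) (kahler_grad (trace_fun N))"
    using lipschitz_kahler_grad by (rule exE)
  then show ?thesis
    using assms by (intro ode_unique[of L "kahler_grad (trace_fun N)" "orbit lam" M C T t])
      (auto simp: kahler_flow_def)
qed

end

section \<open>Block LU coordinates on the cell\<close>

lemma matrix_vector_nth: "(A *v x) $ i = (\<Sum>j\<in>UNIV. A $ i $ j * x $ j)"
  by (simp add: matrix_vector_mult_def)

lemma adjoint_matrix_vector:
  "(\<Sum>i\<in>UNIV. cnj (v $ i) * (G\<^sup>\<dagger> *v x) $ i) = (\<Sum>i\<in>UNIV. cnj ((G *v v) $ i) * x $ i)"
proof -
  have "(\<Sum>i\<in>UNIV. cnj (v $ i) * (G\<^sup>\<dagger> *v x) $ i) = (\<Sum>i\<in>UNIV. \<Sum>j\<in>UNIV. cnj (v $ i) * (cnj (G $ j $ i) * x $ j))"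
    by (simp add: matrix_vector_nth sum_distrib_left)
  also have "\<dots> = (\<Sum>j\<in>UNIV. \<Sum>i\<in>UNIV. cnj (v $ i) * (cnj (G $ j $ i) * x $ j))"
    by (rule sum.swap)
  also have "\<dots> = (\<Sum>i\<in>UNIV. cnj ((G *v v) $ i) * x $ i)"
    by (simp add: matrix_vector_nth sum_distrib_left sum_distrib_right mult_ac)
  finally show ?thesis .
qed

lemma sum_cnj_mult_self: "(\<Sum>i\<in>UNIV. cnj (v $ i) * v $ i) = of_real ((norm (v :: complex ^ 'n::finite))\<^sup>2)"
proof -
  have "(norm v)\<^sup>2 = (\<Sum>i\<in>UNIV. (cmod (v $ i))\<^sup>2)"
    by (simp add: norm_vec_def L2_set_def sum_nonneg)
  then show ?thesis
    by (simp add: complex_norm_square mult.commute del: of_real_power)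
qed

text \<open>One column of the Gram-Schmidt process, obtained by solving the normal equations.\<close>

lemma gram_schmidt_column:
  fixes G :: "'n::{finite, linorder} cmat"
  assumes inv: "H ** G = mat 1"
  shows "\<exists>u. u $ p = 1 \<and> (\<forall>i. p < i \<longrightarrow> u $ i = 0) \<and> (\<forall>i. i < p \<longrightarrow> (G\<^sup>\<dagger> *v (G *v u)) $ i = 0)"
proof -
  define T where "T = dg (\<lambda>i. if i < p then 1 else 0)"
  define Q where "Q = G\<^sup>\<dagger> ** G"
  \<comment> \<open>The Gram matrix \<open>Q\<close> restricted to indices below \<open>p\<close>,
    completed by the identity: solvability of the normal equations becomes invertibility of a square
    matrix. A kernel vector x lives below \<open>p\<close> and has \<bar>Gx\<bar> = 0.\<close>
  define M where "M = T ** Q ** T + (mat 1 - T)"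
  have T: "(T *v x) $ i = (if i < p then x $ i else 0)" for x i
    by (simp add: T_def matrix_vector_nth dg_nth if_distrib[of "\<lambda>x. x * _"] cong: if_cong)
  have Q: "Q *v x = G\<^sup>\<dagger> *v (G *v x)" for x
    by (simp add: Q_def matrix_vector_mul_assoc)
  have M: "(M *v x) $ i = (if i < p then (Q *v (T *v x)) $ i else x $ i)" for x i
  proof -
    have "M *v x = T *v (Q *v (T *v x)) + (x - T *v x)"
      by (simp add: M_def matrix_vector_mult_add_rdistrib matrix_vector_mult_diff_rdistrib
          matrix_vector_mul_assoc matrix_mul_assoc)
    then show ?thesis
      by (simp add: T)
  qed
  have "x = 0" if "M *v x = 0" for x
  proof -
    have x0: "x $ i = 0" if "\<not> i < p" for i
      using M[of x i] that \<open>M *v x = 0\<close> by simp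
    then have Tx: "T *v x = x"
      by (auto simp: vec_eq_iff T)
    have Qx: "(Q *v x) $ i = 0" if "i < p" for i
      using M[of x i] that \<open>M *v x = 0\<close> Tx by simp
    have "(\<Sum>i\<in>UNIV. cnj (x $ i) * (Q *v x) $ i) = 0"
      using x0 Qx by (intro sum.neutral) (metis complex_cnj_zero mult_zero_left mult_zero_right)
    then have "(norm (G *v x))\<^sup>2 = 0"
      by (simp add: Q adjoint_matrix_vector sum_cnj_mult_self del: of_real_power)
    then have "H *v (G *v x) = 0"
      by simp
    then show ?thesis
      by (simp add: matrix_vector_mul_assoc inv)
  qed
  then obtain M' where "M' ** M = mat 1"
    unfolding matrix_left_invertible_ker[symmetric] by (metis matrix_left_invertible_ker)
  then have M': "M ** M' = mat 1"
    using matrix_left_right_inverse by blast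
  define c where "c = T *v (Q *v axis p 1)"
  define y where "y = M' *v c"
  have My: "M *v y = c"
    by (simp add: y_def matrix_vector_mul_assoc M')
  have y0: "y $ i = 0" if "\<not> i < p" for i
    using M[of y i] that by (simp add: My c_def T)
  then have Ty: "T *v y = y"
    by (auto simp: vec_eq_iff T)
  have Qy: "(Q *v y) $ i = (Q *v axis p 1) $ i" if "i < p" for i
    using M[of y i] that by (simp add: My c_def T Ty)
  show ?thesis
  proof (intro exI[of _ "axis p 1 - y"] conjI allI impI)
    show "(axis p 1 - y) $ p = 1"
      using y0[of p] by simp
    show "(axis p 1 - y) $ i = 0" if "p < i" for i
      using y0[of i] that by (simp add: axis_def)
    show "(G\<^sup>\<dagger> *v (G *v (axis p 1 - y))) $ i = 0" if "i < p" for i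
      using Qy[OF that] unfolding Q[symmetric] by (simp add: matrix_vector_mult_diff_distrib)
  qed
qed

text \<open>The columns \<open>G *v u p\<close> are orthogonal because, for i < j,
  \<open>u i\<close> is supported on indices up to i, where
  \<open>G\<^sup>\<dagger> *v (G *v u j)\<close> vanishes. Only normalization is left.\<close>

lemma QR_decomposition:
  fixes G :: "'n::{finite, linorder} cmat"
  assumes inv: "H ** G = mat 1"
  shows "\<exists>R R'. R ** R' = mat 1 \<and> (\<forall>i j. j < i \<longrightarrow> R $ i $ j = 0) \<and> G ** R \<in> unitary_group"
proof -
  obtain u where u: "\<And>p. u p $ p = 1" "\<And>p i. p < i \<Longrightarrow> u p $ i = 0"
      "\<And>p i. i < p \<Longrightarrow> (G\<^sup>\<dagger> *v (G *v u p)) $ i = 0"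
    using gram_schmidt_column[OF inv] by metis
  define v where "v p = G *v u p" for p
  have v0: "norm (v p) \<noteq> 0" for p
  proof
    assume "norm (v p) = 0"
    then have "H *v v p = 0"
      by simp
    then have "u p = 0"
      by (simp add: v_def matrix_vector_mul_assoc inv)
    then show False
      using u(1)[of p] by simp
  qed
  define R where "R = (\<chi> i j. u j $ i / of_real (norm (v j)))"
  let ?U = "G ** R"
  have U: "?U $ i $ j = v j $ i / of_real (norm (v j))" for i j
    by (simp add: R_def mult_nth v_def matrix_vector_nth sum_divide_distrib)
  have gram: "(?U\<^sup>\<dagger> ** ?U) $ i $ j
      = (\<Sum>m\<in>UNIV. cnj (v i $ m) * v j $ m) / of_real (norm (v i) * norm (v j))" for i j
    unfolding mult_nth[of "?U\<^sup>\<dagger>" ?U] conj_transpose_nth U by (simp add: sum_divide_distrib)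
  have orth: "(\<Sum>m\<in>UNIV. cnj (v i $ m) * v j $ m) = 0" if "i < j" for i j
  proof -
    have "(\<Sum>m\<in>UNIV. cnj (v i $ m) * v j $ m) = (\<Sum>m\<in>UNIV. cnj (u i $ m) * (G\<^sup>\<dagger> *v (G *v u j)) $ m)"
      by (simp add: adjoint_matrix_vector v_def)
    also have "\<dots> = 0"
    proof (rule sum.neutral, rule ballI)
      fix m
      show "cnj (u i $ m) * (G\<^sup>\<dagger> *v (G *v u j)) $ m = 0"
        using u(2)[of i m] u(3)[of m j] that by (cases "i < m") auto
    qed
    finally show ?thesis .
  qed
  have orth': "(\<Sum>m\<in>UNIV. cnj (v i $ m) * v j $ m) = 0" if "i \<noteq> j" for i j
  proof (cases "i < j")
    case False
    then have "cnj (\<Sum>m\<in>UNIV. cnj (v j $ m) * v i $ m) = 0"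
      using that by (simp add: orth)
    then show ?thesis
      by (simp add: mult.commute)
  qed (rule orth)
  have "(?U\<^sup>\<dagger> ** ?U) $ i $ j = mat 1 $ i $ j" for i j
    unfolding gram using orth'[of i j] v0[of i]
    by (cases "i = j") (simp_all add: sum_cnj_mult_self mat_def power2_eq_square)
  then have "?U\<^sup>\<dagger> ** ?U = mat 1"
    by (simp only: vec_eq_iff) simp
  then have unit: "?U \<in> unitary_group"
    using matrix_left_right_inverse unfolding unitary_iff by blast
  have "(?U\<^sup>\<dagger> ** G) ** R = mat 1"
    using unit by (simp add: unitary_cancel flip: matrix_mul_assoc)
  then have "R ** (?U\<^sup>\<dagger> ** G) = mat 1"
    using matrix_left_right_inverse by blast
  moreover have "\<forall>i j. j < i \<longrightarrow> R $ i $ j = 0"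
    by (simp add: R_def u)
  ultimately show ?thesis
    using unit by blast
qed

text \<open>The assumption on \<open>b\<close> says that it preserves the range of the idempotent
  \<open>T\<close>; an invertible map of a finite-dimensional space then maps that range onto
  itself, so the inverse preserves it too. \<open>X\<close> is the compression of \<open>b\<close>
  to the range, extended by the identity.\<close>

lemma block_upper_inverse:
  fixes b c T :: "'n::finite cmat"
  assumes b: "b ** T = T ** b ** T" and T: "T ** T = T" and inv: "b ** c = mat 1"
  shows "c ** T = T ** c ** T"
proof -
  have inv': "c ** b = mat 1"
    using inv matrix_left_right_inverse by blast
  define X where "X = T ** b ** T + (mat 1 - T)"
  define Y where "Y = c ** T + (mat 1 - T)"
  have TX: "T ** X = b ** T"
    by (simp add: X_def matrix_mult_add_right matrix_mult_diff_right matrix_mul_assoc T b)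
  have "Y ** X = c ** (T ** X) + (X - T ** X)"
    by (simp add: Y_def matrix_mult_add_left matrix_mult_diff_left matrix_mul_assoc)
  also have "c ** (T ** X) = T"
    by (simp add: TX matrix_mul_assoc inv')
  also have "T + (X - T ** X) = mat 1"
    unfolding TX by (simp add: X_def b[symmetric])
  finally have "X ** Y = mat 1"
    using matrix_left_right_inverse by blast
  then have "T ** X ** Y = T"
    by (simp flip: matrix_mul_assoc)
  then have "c ** b ** (T ** Y) = c ** T"
    by (simp add: TX flip: matrix_mul_assoc)
  then have "T ** Y = c ** T"
    by (simp add: inv')
  moreover have "T ** Y = T ** c ** T"
    by (simp add: Y_def matrix_mult_add_right matrix_mult_diff_right matrix_mul_assoc T)
  ultimately show ?thesis
    by simp
qed

lemma continuous_on_det: "continuous_on S (det :: 'n::finite cmat \<Rightarrow> complex)"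
  unfolding det_def by (intro continuous_intros)

lemma continuous_on_matrix_entries:
  fixes f :: "'a::topological_space \<Rightarrow> 'n::finite cmat"
  assumes "\<And>i j. continuous_on S (\<lambda>x. f x $ i $ j)"
  shows "continuous_on S f"
proof -
  have "continuous_on S (\<lambda>x. \<chi> i j. f x $ i $ j)"
    by (intro continuous_on_vec_lambda assms)
  then show ?thesis
    by simp
qed

section \<open>Coordinates for flags and their continuity\<close>

context gradient_setting
begin

definition E :: "'n cmat set" where "E = {x. \<forall>i j. l j \<le> l i \<longrightarrow> x $ i $ j = 0}"

definition B :: "'n cmat set" where "B = {b. \<forall>i j. l i < l j \<longrightarrow> b $ i $ j = 0}"

text \<open>
  \<open>B\<close> is the parabolic subalgebra stabilizing the standard flag \<open>F\<close>, and \<open>E\<close> is the opposite nilradical;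
  the relation says that the eigenspaces of \<open>L\<close> span the flag \<open>g (1 + x) F\<close>.
\<close>

definition chart_rel :: "'n cmat \<Rightarrow> 'n cmat \<Rightarrow> bool" where
  "chart_rel x L \<longleftrightarrow> x \<in> E \<and> (\<exists>U\<in>unitary_group. \<exists>b\<in>B. g ** (mat 1 + x) = U ** b \<and> L = orbit_pt l U)"

lemma l_less_imp: "l i < l j \<Longrightarrow> j < i"
  using l_antimono[of i j] by (metis leD le_less_linear)

lemma B_mult:
  assumes "b \<in> B" "c \<in> B"
  shows "b ** c \<in> B"
proof -
  have "b $ i $ m * c $ m $ j = 0" if "l i < l j" for i j m
    using assms that by (cases "l i < l m") (auto simp: B_def)
  then show ?thesis
    by (auto simp only: B_def mem_Collect_eq mult_nth intro!: sum.neutral)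
qed

text \<open>Describes \<open>B\<close> as the stabilizer of the coordinate subspaces where
  \<open>l\<close> is at least c, which reduces closure under inverses to
  \<open>block_upper_inverse\<close>.\<close>

lemma B_threshold:
  defines "T \<equiv> \<lambda>c::real. dg (\<lambda>i. if c \<le> l i then 1 else 0) :: 'n cmat"
  shows "b \<in> B \<longleftrightarrow> (\<forall>c. b ** T c = T c ** b ** T c)"
proof
  assume "b \<in> B"
  then show "\<forall>c. b ** T c = T c ** b ** T c"
    by (auto simp: T_def vec_eq_iff B_def)
next
  assume *: "\<forall>c. b ** T c = T c ** b ** T c"
  show "b \<in> B"
    unfolding B_def
  proof (intro CollectI allI impI)
    fix i j assume "l i < l j"
    then show "b $ i $ j = 0"
      using arg_cong[OF spec[OF *, of "l j"], of "\<lambda>X. X $ i $ j"] by (simp add: T_def)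
  qed
qed

lemma B_inverse:
  assumes "b \<in> B" "b ** c = mat 1"
  shows "c \<in> B"
  unfolding B_threshold
proof
  fix t
  let ?T = "dg (\<lambda>i. if t \<le> l i then 1 else 0) :: 'n cmat"
  show "c ** ?T = ?T ** c ** ?T"
  proof (rule block_upper_inverse[OF _ _ assms(2)])
    show "b ** ?T = ?T ** b ** ?T"
      using assms(1) unfolding B_threshold by (rule spec)
    show "?T ** ?T = ?T"
      by (auto simp: dg_mult_dg intro!: arg_cong[of _ _ dg])
  qed
qed

text \<open>Forward substitution for Z = k - 1: membership in \<open>B\<close> or \<open>E\<close>
  leaves one equation per entry, and row i of yZ involves only rows m with l i < l m, which come
  earlier.\<close>

lemma E_cancel:
  assumes y: "y \<in> E" and k: "k \<in> B" and x: "(mat 1 + y) ** k - mat 1 \<in> E"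
  shows "k = mat 1"
proof -
  define Z where "Z = k - mat 1"
  have eq: "(mat 1 + y) ** k - mat 1 = y + Z + y ** Z"
    by (simp add: Z_def matrix_mult_add_left matrix_mult_diff_right)
  have Z: "Z $ i $ j = 0" for i j
  proof (induction "idx i" arbitrary: i rule: less_induct)
    case less
    show ?case
    proof (cases "l i < l j")
      case True
      then show ?thesis
        using k by (auto simp: Z_def B_def mat_def)
    next
      case False
      then have "((mat 1 + y) ** k - mat 1) $ i $ j = 0"
        using x unfolding E_def not_less by blast
      then have "y $ i $ j + Z $ i $ j + (y ** Z) $ i $ j = 0"
        unfolding eq by simp
      moreover have "y $ i $ j = 0"
        using y False by (simp add: E_def)
      moreover have "y $ i $ m * Z $ m $ j = 0" for m
      proof (cases "l m \<le> l i")
        case True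
        then show ?thesis
          using y by (simp add: E_def)
      next
        case False
        then show ?thesis
          using less[of m] l_less_imp[of i m] by simp
      qed
      then have "(y ** Z) $ i $ j = 0"
        unfolding mult_nth by (intro sum.neutral ballI)
      ultimately show ?thesis
        by simp
    qed
  qed
  then have "Z = 0"
    by (simp add: vec_eq_iff)
  then show ?thesis
    by (simp add: Z_def)
qed

lemma unipotent_invertible:
  assumes x: "x \<in> E"
  shows "\<exists>y. y ** (mat 1 + x) = mat 1"
  unfolding matrix_left_invertible_ker
proof (intro allI impI)
  fix v assume v: "(mat 1 + x) *v v = 0"
  have "v $ i = 0" for i
  proof (induction "idx i" arbitrary: i rule: less_induct)
    case less
    have "((mat 1 + x) *v v) $ i = v $ i + (x *v v) $ i"
      by (simp add: matrix_vector_mult_add_rdistrib)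
    moreover have "x $ i $ m * v $ m = 0" for m
    proof (cases "l m \<le> l i")
      case True
      then show ?thesis
        using x by (simp add: E_def)
    next
      case False
      then show ?thesis
        using less[of m] l_less_imp[of i m] by simp
    qed
    then have "(x *v v) $ i = 0"
      unfolding matrix_vector_nth by (intro sum.neutral ballI)
    ultimately show ?case
      using v by simp
  qed
  then show "v = 0"
    by (simp add: vec_eq_iff)
qed

text \<open>QR applied to \<open>g ** (mat 1 + x)\<close>: upper triangular matrices are block upper
  triangular because \<open>l\<close> is antimonotone.\<close>

lemma chart_rel_exists:
  assumes x: "x \<in> E"
  shows "\<exists>L. chart_rel x L"
proof -
  obtain y where "y ** (mat 1 + x) = mat 1"
    using unipotent_invertible[OF x] by (rule exE)
  then have "(y ** g\<^sup>\<dagger>) ** (g ** (mat 1 + x)) = mat 1"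
    using g by (simp add: matrix_mul_assoc unitary_cancel)
  then obtain R R' where R: "R ** R' = mat 1" "\<forall>i j. j < i \<longrightarrow> R $ i $ j = 0"
      "g ** (mat 1 + x) ** R \<in> unitary_group"
    using QR_decomposition by blast
  have "R \<in> B"
    using R(2) l_less_imp by (auto simp: B_def)
  then have "R' \<in> B"
    using R(1) by (rule B_inverse)
  moreover have "g ** (mat 1 + x) = g ** (mat 1 + x) ** R ** R'"
    by (simp add: R(1) flip: matrix_mul_assoc)
  ultimately show ?thesis
    unfolding chart_rel_def using x R(3) by blast
qed

text \<open>Equality means that \<open>W\<^sup>\<dagger> ** U\<close> commutes with the diagonal
  matrix, that is, is block diagonal. For a unitary matrix block upper triangular suffices, since
  its adjoint is its inverse and \<open>B\<close> is closed under inverses.\<close>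

lemma orbit_pt_eq_iff:
  assumes U: "U \<in> unitary_group" and W: "W \<in> unitary_group"
  shows "orbit_pt l U = orbit_pt l W \<longleftrightarrow> W\<^sup>\<dagger> ** U \<in> B"
proof
  let ?Z = "W\<^sup>\<dagger> ** U" and ?d = "dg (\<lambda>i. \<i> * of_real (l i))"
  have Zunit: "?Z \<in> unitary_group"
    using U W by (simp add: unitary_mult unitary_conj_transpose)
  {
    assume eq: "orbit_pt l U = orbit_pt l W"
    have "W\<^sup>\<dagger> ** orbit_pt l U ** U = ?Z ** ?d" "W\<^sup>\<dagger> ** orbit_pt l W ** U = ?d ** ?Z"
      using U W by (simp_all add: orbit_pt_def cj_def matrix_mul_assoc unitary_cancel)
    then have "?Z ** ?d = ?d ** ?Z"
      using eq by simp
    then have "?Z $ i $ j * (\<i> * of_real (l j)) = \<i> * of_real (l i) * ?Z $ i $ j" for i j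
      by (metis dg_mult_nth mult_dg_nth)
    then have "?Z $ i $ j = 0" if "l i < l j" for i j
      using that by (metis complex_i_not_zero less_irrefl mult.commute mult_left_cancel of_real_eq_iff)
    then show "?Z \<in> B"
      by (simp add: B_def)
  next
    assume Z: "?Z \<in> B"
    then have Z': "?Z\<^sup>\<dagger> \<in> B"
      using B_inverse unitary_cancel(1)[OF Zunit] by blast
    have "?Z ** ?d = ?d ** ?Z"
      unfolding vec_eq_iff
    proof (intro allI)
      fix i j
      have "l i < l j \<Longrightarrow> ?Z $ i $ j = 0"
        using Z by (simp add: B_def)
      moreover have "l j < l i \<Longrightarrow> (?Z\<^sup>\<dagger>) $ j $ i = 0"
        using Z' by (simp add: B_def)
      ultimately show "(?Z ** ?d) $ i $ j = (?d ** ?Z) $ i $ j"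
        by (cases "l i" "l j" rule: linorder_cases) simp_all
    qed
    then have "W ** (?Z ** ?d) ** U\<^sup>\<dagger> = W ** (?d ** ?Z) ** U\<^sup>\<dagger>"
      by simp
    then show "orbit_pt l U = orbit_pt l W"
      using U W by (simp add: orbit_pt_def cj_def matrix_mul_assoc unitary_cancel)
  }
qed

text \<open>The unitary in \<open>chart_rel\<close> may be replaced by any \<open>U\<close> that
  diagonalizes the same point, since the two differ by an element of \<open>B\<close>.\<close>

lemma chart_rel_inv:
  assumes "chart_rel x (orbit_pt l U)" and U: "U \<in> unitary_group"
  obtains b b' where "b \<in> B" "b' \<in> B" "b ** b' = mat 1" "g ** (mat 1 + x) = U ** b"
proof -
  obtain W c where W: "W \<in> unitary_group" "c \<in> B" "g ** (mat 1 + x) = W ** c" "orbit_pt l U = orbit_pt l W"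
    using assms(1) unfolding chart_rel_def by blast
  have x: "x \<in> E"
    using assms(1) by (simp add: chart_rel_def)
  define b where "b = U\<^sup>\<dagger> ** W ** c"
  have "U\<^sup>\<dagger> ** W \<in> B"
    using orbit_pt_eq_iff[OF W(1) U] W(4) by simp
  then have b: "b \<in> B"
    unfolding b_def using W(2) B_mult by blast
  have eq: "g ** (mat 1 + x) = U ** b"
    using U by (simp add: b_def W(3) matrix_mul_assoc unitary_cancel)
  obtain y where y: "y ** (mat 1 + x) = mat 1"
    using unipotent_invertible[OF x] by (rule exE)
  have "y ** g\<^sup>\<dagger> ** U ** b = y ** g\<^sup>\<dagger> ** (g ** (mat 1 + x))"
    by (simp add: eq matrix_mul_assoc)
  also have "\<dots> = mat 1"
    using g y by (simp add: matrix_mul_assoc unitary_cancel)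
  finally have "b ** (y ** g\<^sup>\<dagger> ** U) = mat 1"
    using matrix_left_right_inverse by blast
  then show thesis
    using that[OF b _ _ eq] B_inverse[OF b] by blast
qed

lemma chart_rel_functional:
  assumes L: "chart_rel x L" and M: "chart_rel x M"
  shows "L = M"
proof -
  obtain W where W: "W \<in> unitary_group" "M = orbit_pt l W"
    using M unfolding chart_rel_def by blast
  obtain U where U: "U \<in> unitary_group" "L = orbit_pt l U"
    using L unfolding chart_rel_def by blast
  obtain b b' where b: "b \<in> B" "b' \<in> B" "b ** b' = mat 1" "g ** (mat 1 + x) = U ** b"
    using chart_rel_inv[OF _ U(1)] L U(2) by metis
  obtain c c' where c: "c \<in> B" "c' \<in> B" "c ** c' = mat 1" "g ** (mat 1 + x) = W ** c"
    using chart_rel_inv[OF _ W(1)] M W(2) by metis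
  have "W\<^sup>\<dagger> ** U = W\<^sup>\<dagger> ** (U ** b) ** b'"
    by (simp add: b(3) flip: matrix_mul_assoc)
  also have "\<dots> = c ** b'"
    using W(1) by (simp add: b(4)[symmetric] c(4) matrix_mul_assoc unitary_cancel)
  finally show ?thesis
    using B_mult[OF c(1) b(2)] orbit_pt_eq_iff[OF U(1) W(1)] U(2) W(2) by simp
qed

lemma factorization_unique:
  assumes x: "x \<in> E" and y: "y \<in> E" and b: "b \<in> B" "b ** b' = mat 1" and c: "c \<in> B"
    and eq: "(mat 1 + x) ** b = (mat 1 + y) ** c"
  shows "x = y" "b = c"
proof -
  have "(mat 1 + y) ** (c ** b') = (mat 1 + x) ** b ** b'"
    by (simp add: eq matrix_mul_assoc)
  then have k: "(mat 1 + y) ** (c ** b') = mat 1 + x"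
    by (simp add: b(2) flip: matrix_mul_assoc)
  have "c ** b' = mat 1"
    by (rule E_cancel[OF y]) (use B_mult[OF c B_inverse[OF b]] x k in auto)
  then show xy: "x = y"
    using k by simp
  have "c = c ** (b' ** b)"
    using b(2) matrix_left_right_inverse[of b b'] by simp
  also have "\<dots> = b"
    using \<open>c ** b' = mat 1\<close> by (simp add: matrix_mul_assoc)
  finally show "b = c" ..
qed

definition chart :: "'n cmat \<Rightarrow> 'n cmat" where "chart x = (THE L. chart_rel x L)"

lemma chart_rel_chart: "x \<in> E \<Longrightarrow> chart_rel x (chart x)"
  unfolding chart_def by (rule theI') (use chart_rel_exists chart_rel_functional in blast)

lemma chart_rel_iff: "chart_rel x L \<longleftrightarrow> x \<in> E \<and> L = chart x"
proof
  assume L: "chart_rel x L"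
  then have "x \<in> E"
    by (simp add: chart_rel_def)
  then show "x \<in> E \<and> L = chart x"
    using chart_rel_functional[OF L chart_rel_chart] by simp
qed (use chart_rel_chart in simp)

lemma chart_in_orbit: "x \<in> E \<Longrightarrow> chart x \<in> orbit lam"
  using chart_rel_chart[of x] unfolding chart_rel_def orbit_lam by blast

lemma subspace_E: "subspace E"
  by (auto simp: subspace_def E_def)

lemma closed_B: "closed B"
  unfolding B_def by (intro closed_Collect_all closed_Collect_imp closed_Collect_eq continuous_intros) simp

lemma continuous_on_orbit_pt: "continuous_on S (orbit_pt l)"
  unfolding orbit_pt_def cj_def by (intro continuous_intros)

lemma compact_orbit: "compact (orbit lam :: 'n cmat set)"
  unfolding orbit_lam by (intro compact_continuous_image continuous_on_orbit_pt compact_unitary_group)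

text \<open>The unitary factor is not chosen continuously. Instead the graph is the projection,
  along the compact unitary group, of a closed set of triples (U, x, L), and a closed graph with
  compact target gives continuity.\<close>

lemma continuous_on_chart: "continuous_on E chart"
proof (rule continuous_from_closed_graph[OF compact_orbit])
  show "chart \<in> E \<rightarrow> orbit lam"
    using chart_in_orbit by blast
  let ?T = "{p :: 'n cmat \<times> 'n cmat \<times> 'n cmat. fst (snd p) \<in> E} \<inter>
      {p. (fst p)\<^sup>\<dagger> ** (g ** (mat 1 + fst (snd p))) \<in> B} \<inter> {p. snd (snd p) = orbit_pt l (fst p)}"
  have "closed ?T"
  proof (intro closed_Int)
    show "closed {p :: 'n cmat \<times> 'n cmat \<times> 'n cmat. fst (snd p) \<in> E}"
      using closed_vimage[OF closed_subspace[OF subspace_E], of "\<lambda>p. fst (snd p)"]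
      unfolding vimage_def by this (intro continuous_intros)
    show "closed {p :: 'n cmat \<times> 'n cmat \<times> 'n cmat. (fst p)\<^sup>\<dagger> ** (g ** (mat 1 + fst (snd p))) \<in> B}"
      using closed_vimage[OF closed_B, of "\<lambda>p. (fst p)\<^sup>\<dagger> ** (g ** (mat 1 + fst (snd p)))"]
      unfolding vimage_def by this (intro continuous_intros)
    show "closed {p :: 'n cmat \<times> 'n cmat \<times> 'n cmat. snd (snd p) = orbit_pt l (fst p)}"
      by (intro closed_Collect_eq continuous_intros continuous_on_compose2[OF continuous_on_orbit_pt[of UNIV]]) auto
  qed
  then have "closed {q. \<exists>U. U \<in> unitary_group \<and> (U, q) \<in> ?T}"
    by (rule closed_compact_projection[OF compact_unitary_group])
  also have "{q. \<exists>U. U \<in> unitary_group \<and> (U, q) \<in> ?T} = (\<lambda>x. (x, chart x)) ` E"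
  proof -
    have "(\<exists>U. U \<in> unitary_group \<and> (U, (x, L)) \<in> ?T) \<longleftrightarrow> chart_rel x L" for x L
    proof
      assume "chart_rel x L"
      then obtain U b where U: "x \<in> E" "U \<in> unitary_group" "b \<in> B" "g ** (mat 1 + x) = U ** b" "L = orbit_pt l U"
        unfolding chart_rel_def by blast
      then have "U\<^sup>\<dagger> ** (g ** (mat 1 + x)) \<in> B"
        by (simp add: matrix_mul_assoc unitary_cancel)
      then show "\<exists>U. U \<in> unitary_group \<and> (U, (x, L)) \<in> ?T"
        using U by (intro exI[of _ U]) simp
    next
      assume "\<exists>U. U \<in> unitary_group \<and> (U, (x, L)) \<in> ?T"
      then obtain U where U: "U \<in> unitary_group" "x \<in> E" "U\<^sup>\<dagger> ** (g ** (mat 1 + x)) \<in> B" "L = orbit_pt l U"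
        by auto
      have "g ** (mat 1 + x) = U ** (U\<^sup>\<dagger> ** (g ** (mat 1 + x)))"
        using U(1) by (simp add: matrix_mul_assoc unitary_cancel)
      then show "chart_rel x L"
        unfolding chart_rel_def using U by blast
    qed
    then show ?thesis
      unfolding chart_rel_iff by (auto simp: set_eq_iff image_iff)
  qed
  finally show "closed ((\<lambda>x. (x, chart x)) ` E)" .
qed

section \<open>Block LU factorization and openness of the cell\<close>

definition E_part :: "'n cmat \<Rightarrow> 'n cmat" where
  "E_part X = (\<chi> i j. if l i < l j then X $ i $ j else 0)"

definition B_part :: "'n cmat \<Rightarrow> 'n cmat" where
  "B_part X = (\<chi> i j. if l i < l j then 0 else X $ i $ j)"

lemma E_part_mem: "E_part X \<in> E" and B_part_mem: "B_part X \<in> B"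
  by (auto simp: E_part_def B_part_def E_def B_def)

lemma parts_add:
  assumes "x \<in> E" "b \<in> B"
  shows "E_part (x + b) = x" "B_part (x + b) = b"
  using assms by (auto simp: E_part_def B_part_def E_def B_def vec_eq_iff)

lemma parts_sum: "E_part X + B_part X = X"
  by (auto simp: E_part_def B_part_def vec_eq_iff)

lemma continuous_on_parts [continuous_intros]: "continuous_on S E_part" "continuous_on S B_part"
proof -
  have entry: "continuous_on S (\<lambda>X :: 'n cmat. X $ i $ j)" for i j
    by (intro continuous_intros)
  have "continuous_on S (\<lambda>X. E_part X $ i $ j)" "continuous_on S (\<lambda>X. B_part X $ i $ j)" for i j
    using entry[of i j] by (cases "l i < l j"; simp add: E_part_def B_part_def)+
  then show "continuous_on S E_part" "continuous_on S B_part"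
    by (intro continuous_on_matrix_entries; simp)+
qed

text \<open>The block LU factorization is an open embedding by invariance of domain.\<close>

lemma block_LU:
  obtains Om \<xi> where "open Om" "continuous_on Om \<xi>"
    "\<And>Z. Z \<in> Om \<longleftrightarrow> (\<exists>x\<in>E. \<exists>b\<in>B. \<exists>b'. b ** b' = mat 1 \<and> Z = (mat 1 + x) ** b)"
    "\<And>x b b'. x \<in> E \<Longrightarrow> b \<in> B \<Longrightarrow> b ** b' = mat 1 \<Longrightarrow> \<xi> ((mat 1 + x) ** b) = x"
proof -
  define D0 where "D0 = {X. \<exists>c. B_part X ** c = mat 1}"
  \<comment> \<open>The parts in \<open>E\<close> and \<open>B\<close> are complementary, so one
    matrix \<open>X\<close> encodes a pair (x, b), and \<open>\<phi>\<close> maps an open set of the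
    matrix space into that same space, as invariance of domain requires.\<close>
  define \<phi> where "\<phi> X = (mat 1 + E_part X) ** B_part X" for X
  have D0_det: "D0 = {X. det (B_part X) \<noteq> 0}"
    unfolding D0_def invertible_det_nz[symmetric] invertible_right_inverse by simp
  have "open D0"
    unfolding D0_det
    by (intro open_Collect_neq continuous_on_compose2[OF continuous_on_det[of UNIV]] continuous_intros) auto
  moreover have cont: "continuous_on D0 \<phi>"
    unfolding \<phi>_def by (intro continuous_intros)
  moreover have inj: "inj_on \<phi> D0"
  proof (rule inj_onI)
    fix X Y assume "X \<in> D0" "Y \<in> D0" and eq: "\<phi> X = \<phi> Y"
    then obtain c where c: "B_part X ** c = mat 1"
      unfolding D0_def by blast
    have parts: "E_part X = E_part Y" "B_part X = B_part Y"
      using factorization_unique[OF E_part_mem[of X] E_part_mem[of Y] B_part_mem[of X] c B_part_mem[of Y]] eq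
      by (simp_all add: \<phi>_def)
    have "X = E_part X + B_part X"
      by (rule parts_sum[symmetric])
    also have "\<dots> = E_part Y + B_part Y"
      by (simp only: parts)
    also have "\<dots> = Y"
      by (rule parts_sum)
    finally show "X = Y" .
  qed
  ultimately obtain \<psi> where \<psi>: "homeomorphism D0 (\<phi> ` D0) \<phi> \<psi>"
    using invariance_of_domain_homeomorphism[of D0 \<phi>] by auto
  have op: "open (\<phi> ` D0)"
    using \<open>open D0\<close> cont inj by (intro invariance_of_domain)
  have fac: "x + b \<in> D0" "\<phi> (x + b) = (mat 1 + x) ** b"
    if "x \<in> E" "b \<in> B" "b ** b' = mat 1" for x b b'
    using that by (auto simp: D0_def \<phi>_def parts_add)
  show thesis
  proof (rule that[OF op, of "\<lambda>Z. E_part (\<psi> Z)"])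
    show "continuous_on (\<phi> ` D0) (\<lambda>Z. E_part (\<psi> Z))"
      using homeomorphism_cont2[OF \<psi>] by (intro continuous_on_compose2[OF continuous_on_parts(1)[of UNIV]]) auto
    show "Z \<in> \<phi> ` D0 \<longleftrightarrow> (\<exists>x\<in>E. \<exists>b\<in>B. \<exists>b'. b ** b' = mat 1 \<and> Z = (mat 1 + x) ** b)" for Z
    proof
      assume "Z \<in> \<phi> ` D0"
      then obtain X c where "B_part X ** c = mat 1" "Z = (mat 1 + E_part X) ** B_part X"
        by (auto simp: D0_def \<phi>_def)
      then show "\<exists>x\<in>E. \<exists>b\<in>B. \<exists>b'. b ** b' = mat 1 \<and> Z = (mat 1 + x) ** b"
        using E_part_mem B_part_mem by blast
    next
      assume "\<exists>x\<in>E. \<exists>b\<in>B. \<exists>b'. b ** b' = mat 1 \<and> Z = (mat 1 + x) ** b"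
      then show "Z \<in> \<phi> ` D0"
        by (elim bexE conjE exE) (use fac in \<open>simp add: image_iff, metis\<close>)
    qed
    show "E_part (\<psi> ((mat 1 + x) ** b)) = x" if "x \<in> E" "b \<in> B" "b ** b' = mat 1" for x b b'
      using homeomorphism_apply1[OF \<psi> fac(1)[OF that]] that
      by (simp add: fac(2)[OF that] parts_add)
  qed
qed

definition cell :: "'n cmat set" where "cell = chart ` E"

text \<open>A point lies in the cell iff \<open>g\<^sup>\<dagger> ** U\<close> has a block LU
  factorization, and its coordinate is then the factor read off by \<open>\<xi>\<close>. The chart
  is a closed map onto the cell because closed sets of coordinates come from compact sets of
  unitaries.\<close>

lemma chart_homeomorphism:
  obtains \<eta> where "homeomorphism E cell chart \<eta>" "openin (top_of_set (orbit lam)) cell"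
proof -
  obtain Om \<xi> where Om: "open Om" "continuous_on Om \<xi>"
    "\<And>Z. Z \<in> Om \<longleftrightarrow> (\<exists>x\<in>E. \<exists>b\<in>B. \<exists>b'. b ** b' = mat 1 \<and> Z = (mat 1 + x) ** b)"
    "\<And>x b b'. x \<in> E \<Longrightarrow> b \<in> B \<Longrightarrow> b ** b' = mat 1 \<Longrightarrow> \<xi> ((mat 1 + x) ** b) = x"
    by (rule block_LU, rule that)
  have fwd: "g\<^sup>\<dagger> ** U \<in> Om" "\<xi> (g\<^sup>\<dagger> ** U) = x"
    if x: "x \<in> E" and U: "U \<in> unitary_group" and eq_pt: "chart x = orbit_pt l U" for x U
  proof -
    have "chart_rel x (orbit_pt l U)"
      using chart_rel_chart[OF x] eq_pt by simp
    then obtain b b' where b: "b \<in> B" "b' \<in> B" "b ** b' = mat 1" "g ** (mat 1 + x) = U ** b"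
      using U by (rule chart_rel_inv)
    have "g\<^sup>\<dagger> ** U = g\<^sup>\<dagger> ** (U ** b) ** b'"
      by (simp add: b(3) flip: matrix_mul_assoc)
    also have "\<dots> = (mat 1 + x) ** b'"
      using g by (simp add: b(4)[symmetric] matrix_mul_assoc unitary_cancel)
    finally have eq: "g\<^sup>\<dagger> ** U = (mat 1 + x) ** b'" .
    have inv: "b' ** b = mat 1"
      using b(3) matrix_left_right_inverse by blast
    show "g\<^sup>\<dagger> ** U \<in> Om"
      unfolding eq Om(3) using x b(2) inv by blast
    show "\<xi> (g\<^sup>\<dagger> ** U) = x"
      unfolding eq using x b(2) inv by (rule Om(4))
  qed
  have bwd: "\<exists>x\<in>E. chart x = orbit_pt l U" if U: "U \<in> unitary_group" and mem: "g\<^sup>\<dagger> ** U \<in> Om" for U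
  proof -
    obtain x b b' where x: "x \<in> E" "b \<in> B" "b ** b' = mat 1" "g\<^sup>\<dagger> ** U = (mat 1 + x) ** b"
      using mem unfolding Om(3) by (elim bexE exE conjE)
    have "U ** b' = g ** (g\<^sup>\<dagger> ** U) ** b'"
      using g by (simp add: matrix_mul_assoc unitary_cancel)
    also have "\<dots> = g ** (mat 1 + x) ** (b ** b')"
      by (simp add: x(4) matrix_mul_assoc)
    finally have "g ** (mat 1 + x) = U ** b'"
      by (simp add: x(3))
    then have "chart_rel x (orbit_pt l U)"
      unfolding chart_rel_def using x(1) U B_inverse[OF x(2,3)] by blast
    then show ?thesis
      unfolding chart_rel_iff by (intro bexI[of _ x]) simp_all
  qed
  \<comment> \<open>The implication also admits all unitaries without a factorization. What is
    excluded is thus an open condition, so the set of unitaries is compact; intersecting with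
    \<open>cell\<close> in \<open>img\<close> removes the extra points.\<close>
  have clo: "closed (orbit_pt l ` {U \<in> unitary_group. g\<^sup>\<dagger> ** U \<in> Om \<longrightarrow> \<xi> (g\<^sup>\<dagger> ** U) \<in> C})"
    if "closedin (top_of_set E) C" for C
  proof -
    let ?K = "{U \<in> unitary_group. g\<^sup>\<dagger> ** U \<in> Om \<longrightarrow> \<xi> (g\<^sup>\<dagger> ** U) \<in> C}"
    have "closed C"
      using that closed_subspace[OF subspace_E] by (metis closedin_closed_eq)
    then have "open (Om \<inter> \<xi> -` (- C))"
      using Om(1,2) by (intro continuous_open_preimage) auto
    then have "open ((\<lambda>U. g\<^sup>\<dagger> ** U) -` (Om \<inter> \<xi> -` (- C)))"
      by (intro open_vimage continuous_intros)
    moreover have "?K = unitary_group - (\<lambda>U. g\<^sup>\<dagger> ** U) -` (Om \<inter> \<xi> -` (- C))"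
      by auto
    ultimately have "compact ?K"
      using compact_diff[OF compact_unitary_group] by simp
    then show ?thesis
      by (intro compact_imp_closed compact_continuous_image continuous_on_orbit_pt)
  qed
  have img: "chart ` C = cell \<inter> orbit_pt l ` {U \<in> unitary_group. g\<^sup>\<dagger> ** U \<in> Om \<longrightarrow> \<xi> (g\<^sup>\<dagger> ** U) \<in> C}"
    if sub: "C \<subseteq> E" for C
  proof (intro equalityI subsetI)
    fix L assume "L \<in> chart ` C"
    then obtain x where x: "x \<in> C" "x \<in> E" "L = chart x"
      using sub by blast
    obtain U where U: "U \<in> unitary_group" "chart x = orbit_pt l U"
      using chart_in_orbit[OF x(2)] unfolding orbit_lam by (elim imageE)
    have "L \<in> cell"
      using x by (simp add: cell_def)
    moreover have "L \<in> orbit_pt l ` {U \<in> unitary_group. g\<^sup>\<dagger> ** U \<in> Om \<longrightarrow> \<xi> (g\<^sup>\<dagger> ** U) \<in> C}"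
      using fwd[OF x(2) U] x U by (intro image_eqI[of _ _ U]) simp_all
    ultimately show "L \<in> cell \<inter> orbit_pt l ` {U \<in> unitary_group. g\<^sup>\<dagger> ** U \<in> Om \<longrightarrow> \<xi> (g\<^sup>\<dagger> ** U) \<in> C}"
      by (rule IntI)
  next
    fix L assume "L \<in> cell \<inter> orbit_pt l ` {U \<in> unitary_group. g\<^sup>\<dagger> ** U \<in> Om \<longrightarrow> \<xi> (g\<^sup>\<dagger> ** U) \<in> C}"
    then obtain x U where x: "x \<in> E" "L = chart x" "U \<in> unitary_group" "L = orbit_pt l U"
      "g\<^sup>\<dagger> ** U \<in> Om \<longrightarrow> \<xi> (g\<^sup>\<dagger> ** U) \<in> C"
      unfolding cell_def by (elim IntE imageE CollectE conjE)
    then show "L \<in> chart ` C"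
      using fwd[of x U] by (intro image_eqI[of _ _ x]) simp_all
  qed
  have inj: "inj_on chart E"
  proof (rule inj_onI)
    fix x y assume xy: "x \<in> E" "y \<in> E" "chart x = chart y"
    obtain U where U: "U \<in> unitary_group" "chart x = orbit_pt l U"
      using chart_in_orbit[OF xy(1)] unfolding orbit_lam by (elim imageE)
    have "\<xi> (g\<^sup>\<dagger> ** U) = x"
      using xy(1) U by (rule fwd(2))
    moreover have "\<xi> (g\<^sup>\<dagger> ** U) = y"
      using xy(2) U(1) U(2)[unfolded xy(3)] by (rule fwd(2))
    ultimately show "x = y"
      by (rule trans[OF sym])
  qed
  have "closedin (top_of_set cell) (chart ` C)" if "closedin (top_of_set E) C" for C
    using img[OF closedin_imp_subset[OF that]] clo[OF that] by (simp add: closedin_closed_Int)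
  then obtain \<eta> where \<eta>: "homeomorphism E cell chart \<eta>"
    by (rule homeomorphism_injective_closed_map[OF continuous_on_chart cell_def[symmetric] inj])
  \<comment> \<open>The case of the empty set of coordinates: only the unitaries without a
    factorization remain, and their points form the closed complement of the cell.\<close>
  have "orbit lam - cell = orbit_pt l ` {U \<in> unitary_group. g\<^sup>\<dagger> ** U \<in> Om \<longrightarrow> \<xi> (g\<^sup>\<dagger> ** U) \<in> {}}" (is "_ = ?K")
  proof (intro equalityI subsetI)
    fix L assume L: "L \<in> orbit lam - cell"
    then obtain U where U: "U \<in> unitary_group" "L = orbit_pt l U"
      unfolding orbit_lam by (elim DiffE imageE)
    have "g\<^sup>\<dagger> ** U \<notin> Om"
    proof
      assume "g\<^sup>\<dagger> ** U \<in> Om"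
      then have "\<exists>x\<in>E. chart x = L"
        unfolding U(2) by (rule bwd[OF U(1)])
      then have "L \<in> cell"
        unfolding cell_def by (elim bexE) (rule image_eqI, rule sym)
      then show False
        using L by (elim DiffE) (rule notE)
    qed
    then show "L \<in> ?K"
      using U by (intro image_eqI[of _ _ U]) simp_all
  next
    fix L assume L: "L \<in> ?K"
    then have "L \<in> orbit lam"
      unfolding orbit_lam by (rule rev_subsetD) (intro image_mono, simp)
    moreover have "L \<notin> cell"
      using img[of "{}"] L by (auto simp only: image_empty empty_subsetI)
    ultimately show "L \<in> orbit lam - cell"
      by (rule DiffI)
  qed
  then have "closed (orbit lam - cell)"
    using clo[of "{}"] by simp
  then have "openin (top_of_set (orbit lam)) (orbit lam - (orbit lam - cell))"
    by (intro openin_diff closed_subset) auto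
  moreover have "orbit lam - (orbit lam - cell) = cell"
    using chart_in_orbit by (auto simp: cell_def)
  ultimately show thesis
    using that[OF \<eta>] by simp
qed

end

section \<open>The flow in coordinates and the attractor\<close>

text \<open>Lets a difference quotient be multiplied by merely continuous factors using limit
  rules.\<close>

lemma has_vector_derivative_iff_slope:
  "(f has_vector_derivative D) (at t) \<longleftrightarrow> ((\<lambda>s. (f s - f t) /\<^sub>R (s - t)) \<longlongrightarrow> D) (at t)"
proof -
  have "(f has_vector_derivative D) (at t) \<longleftrightarrow>
      ((\<lambda>s. norm ((f s - f t) - (s - t) *\<^sub>R D) / norm (s - t)) \<longlongrightarrow> 0) (at t)"
    by (simp add: has_vector_derivative_def has_derivative_iff_norm bounded_linear_scaleR_left)
  also have "\<dots> \<longleftrightarrow> ((\<lambda>s. norm ((f s - f t) /\<^sub>R (s - t) - D)) \<longlongrightarrow> 0) (at t)"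
  proof (rule filterlim_cong[OF refl refl])
    show "\<forall>\<^sub>F s in at t. norm ((f s - f t) - (s - t) *\<^sub>R D) / norm (s - t) = norm ((f s - f t) /\<^sub>R (s - t) - D)"
      unfolding eventually_at_filter
    proof (rule always_eventually, intro allI impI)
      fix s assume "s \<noteq> t"
      then have "(f s - f t) /\<^sub>R (s - t) - D = ((f s - f t) - (s - t) *\<^sub>R D) /\<^sub>R (s - t)"
        by (simp add: scaleR_diff_right)
      then show "norm ((f s - f t) - (s - t) *\<^sub>R D) / norm (s - t) = norm ((f s - f t) /\<^sub>R (s - t) - D)"
        by (simp add: divide_inverse mult.commute)
    qed
  qed
  also have "\<dots> \<longleftrightarrow> ((\<lambda>s. (f s - f t) /\<^sub>R (s - t)) \<longlongrightarrow> D) (at t)"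
    by (simp add: tendsto_norm_zero_iff Lim_null[symmetric])
  finally show ?thesis .
qed

lemma tendsto_matrix_entries:
  fixes f :: "'a \<Rightarrow> 'n::finite cmat"
  assumes "\<And>i j. ((\<lambda>x. f x $ i $ j) \<longlongrightarrow> L $ i $ j) F"
  shows "(f \<longlongrightarrow> L) F"
  by (intro vec_tendstoI assms)

lemma has_vector_derivative_matrix_entries:
  fixes f :: "real \<Rightarrow> 'n::finite cmat"
  assumes "\<And>i j. ((\<lambda>x. f x $ i $ j) has_vector_derivative L $ i $ j) (at t)"
  shows "(f has_vector_derivative L) (at t)"
  using assms unfolding has_vector_derivative_iff_slope by (intro tendsto_matrix_entries) simp

text \<open>
  \<open>P t\<close> is the orthogonal projection onto the range of \<open>M t\<close>; the product \<open>C t ** P t\<close> lifts it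
  through \<open>M t\<close>. The difference of two such projections is linear in the difference of the \<open>M t\<close>.
\<close>

lemma projection_has_vector_derivative:
  fixes P M C :: "real \<Rightarrow> 'n::finite cmat"
  assumes herm: "\<And>s. (P s)\<^sup>\<dagger> = P s" and bnd: "\<And>s. norm (P s) \<le> K"
    and PM: "\<And>s. P s ** M s = M s" and MCP: "\<And>s. M s ** C s ** P s = P s"
    and C: "(C \<longlongrightarrow> C t) (at t)" and M: "(M has_vector_derivative M') (at t)"
  defines "Z \<equiv> (mat 1 - P t) ** M' ** C t ** P t"
  shows "(P has_vector_derivative Z + Z\<^sup>\<dagger>) (at t)"
proof -
  \<comment> \<open>\<open>mat 1 - P r\<close> annihilates \<open>M r\<close>, while
    \<open>M s ** C s\<close> fixes the range of \<open>P s\<close>.\<close>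
  have X: "P s - P r ** P s = (mat 1 - P r) ** (M s - M r) ** C s ** P s" for r s
  proof -
    have "(mat 1 - P r) ** (M s - M r) ** C s ** P s = (mat 1 - P r) ** (M s ** C s ** P s)
        - (M r - P r ** M r) ** C s ** P s"
      by (simp add: matrix_mult_diff_left matrix_mult_diff_right matrix_mul_assoc)
    also have "\<dots> = (mat 1 - P r) ** P s"
      by (simp add: MCP PM)
    also have "\<dots> = P s - P r ** P s"
      by (simp add: matrix_mult_diff_left)
    finally show ?thesis by (rule sym)
  qed
  \<comment> \<open>P s - P t is the sum of P s - P t P s and the adjoint of P s P t - P t; both
    have the form treated in \<open>X\<close>.\<close>
  have diff: "P s - P t = (mat 1 - P t) ** (M s - M t) ** C s ** P s
      + ((mat 1 - P s) ** (M s - M t) ** C t ** P t)\<^sup>\<dagger>" for s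
  proof -
    have "(mat 1 - P s) ** (M s - M t) ** C t ** P t = - ((mat 1 - P s) ** (M t - M s) ** C t ** P t)"
      by (simp add: matrix_mult_diff_left matrix_mult_diff_right)
    also have "\<dots> = P s ** P t - P t"
      by (simp flip: X)
    finally have "((mat 1 - P s) ** (M s - M t) ** C t ** P t)\<^sup>\<dagger> = P t ** P s - P t"
      by (simp add: conj_transpose_diff conj_transpose_mult herm)
    then show ?thesis
      by (simp flip: X)
  qed
  have MC: "((\<lambda>s. (M s - M t) ** C s) \<longlongrightarrow> 0) (at t)"
  proof -
    have "(M \<longlongrightarrow> M t) (at t)"
      using M has_vector_derivative_continuous isCont_def by blast
    then have "((\<lambda>s. (M s - M t) ** C s) \<longlongrightarrow> (M t - M t) ** C t) (at t)"
      by (intro tendsto_intros C)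
    then show ?thesis
      by (simp add: vec_eq_iff mult_nth)
  qed
  \<comment> \<open>The slope contains \<open>P s\<close> itself, so continuity has to come first;
    there the uniform bound on \<open>P\<close> is enough.\<close>
  have cont: "(P \<longlongrightarrow> P t) (at t)"
  proof -
    have B: "Bfun P (at t)"
      using bnd by (intro BfunI[of _ K]) simp
    have "Zfun (\<lambda>s. (M s - M t) ** C s) (at t)"
      using MC by (simp add: tendsto_Zfun_iff)
    then have "Zfun (\<lambda>s. (M s - M t) ** C s ** P s) (at t)"
      using B by (rule bounded_bilinear.Zfun_prod_Bfun[OF bounded_bilinear_matrix_mult])
    then have Z1: "((\<lambda>s. (M s - M t) ** C s ** P s) \<longlongrightarrow> 0) (at t)"
      by (simp add: tendsto_Zfun_iff)
    have B': "Bfun (\<lambda>s. mat 1 - P s) (at t)"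
    proof (rule BfunI[of _ "norm (mat 1 :: 'n cmat) + K"], rule always_eventually, rule allI)
      show "norm (mat 1 - P s) \<le> norm (mat 1 :: 'n cmat) + K" for s
        using norm_triangle_ineq4[of "mat 1" "P s"] bnd[of s] by linarith
    qed
    have "(M \<longlongrightarrow> M t) (at t)"
      using M has_vector_derivative_continuous isCont_def by blast
    then have "Zfun (\<lambda>s. M s - M t) (at t)"
      by (simp add: tendsto_Zfun_iff)
    then have "Zfun (\<lambda>s. (mat 1 - P s) ** (M s - M t)) (at t)"
      using B' by (intro bounded_bilinear.Bfun_prod_Zfun[OF bounded_bilinear_matrix_mult])
    then have Z2: "((\<lambda>s. (mat 1 - P s) ** (M s - M t)) \<longlongrightarrow> 0) (at t)"
      by (simp add: tendsto_Zfun_iff)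
    have "((\<lambda>s. (mat 1 - P t) ** ((M s - M t) ** C s ** P s)
        + ((mat 1 - P s) ** (M s - M t) ** C t ** P t)\<^sup>\<dagger>) \<longlongrightarrow>
        (mat 1 - P t) ** 0 + (0 ** C t ** P t)\<^sup>\<dagger>) (at t)"
      by (intro tendsto_intros Z1 Z2)
    then have "((\<lambda>s. P s - P t) \<longlongrightarrow> (mat 1 - P t) ** 0 + (0 ** C t ** P t)\<^sup>\<dagger>) (at t)"
      unfolding diff by (simp only: matrix_mul_assoc)
    moreover have "(mat 1 - P t) ** 0 + (0 ** C t ** P t)\<^sup>\<dagger> = 0"
      by (simp add: vec_eq_iff mult_nth)
    ultimately show ?thesis
      by (simp add: Lim_null[symmetric])
  qed
  have slope: "(P s - P t) /\<^sub>R (s - t) = (mat 1 - P t) ** ((M s - M t) /\<^sub>R (s - t)) ** C s ** P s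
      + ((mat 1 - P s) ** ((M s - M t) /\<^sub>R (s - t)) ** C t ** P t)\<^sup>\<dagger>" for s
    unfolding diff[of s] scaleR_add_right
    by (simp add: scaleR_eq_cscale cscale_mult_left cscale_mult_right conj_transpose_cscale)
  show ?thesis
    unfolding has_vector_derivative_iff_slope slope Z_def
    using M[unfolded has_vector_derivative_iff_slope] by (intro tendsto_intros cont C)
qed

context gradient_setting
begin

definition flow :: "real \<Rightarrow> 'n cmat \<Rightarrow> 'n cmat" where
  "flow t x = (\<chi> i j. of_real (exp (t * (a i - a j))) * x $ i $ j)"

lemma flow_mem_E: "x \<in> E \<Longrightarrow> flow t x \<in> E"
  by (simp add: E_def flow_def)

lemma flow_0 [simp]: "flow 0 x = x"
  by (simp add: flow_def)

lemma flow_flow: "flow s (flow t x) = flow (s + t) x"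
  by (simp add: flow_def exp_add distrib_right mult.assoc)

definition diag_exp :: "real \<Rightarrow> 'n cmat" where
  "diag_exp t = dg (\<lambda>i. of_real (exp (t * a i)))"

text \<open>The right factor is diagonal, hence in \<open>B\<close>, and g times the left factor is
  exp(tA) g. So the flag of \<open>flow t x\<close> is the flag of \<open>x\<close> moved by
  exp(tA).\<close>

lemma one_plus_flow: "mat 1 + flow t x = diag_exp t ** (mat 1 + x) ** diag_exp (- t)"
  by (simp add: vec_eq_iff flow_def diag_exp_def mat_def algebra_simps exp_diff exp_minus divide_inverse)

lemma diag_exp_inverse: "diag_exp t ** diag_exp (- t) = mat 1"
  by (simp add: diag_exp_def dg_mult_dg mat_1_eq_dg exp_minus flip: of_real_mult)

lemma tendsto_diag_exp: "((\<lambda>s. diag_exp (c * s)) \<longlongrightarrow> diag_exp (c * t)) (at t)"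
proof (rule tendsto_matrix_entries)
  fix i j
  show "((\<lambda>s. diag_exp (c * s) $ i $ j) \<longlongrightarrow> diag_exp (c * t) $ i $ j) (at t)"
    unfolding diag_exp_def dg_nth by (cases "i = j") (auto intro!: tendsto_intros)
qed

lemma one_plus_flow_has_vector_derivative:
  fixes x :: "'n cmat"
  defines "Y \<equiv> \<lambda>t. mat 1 + flow t x" and "d \<equiv> dg (\<lambda>i. of_real (a i))"
  shows "(Y has_vector_derivative d ** Y t - Y t ** d) (at t)"
proof (rule has_vector_derivative_matrix_entries)
  fix i j
  have "((\<lambda>s. mat 1 $ i $ j + exp (s * (a i - a j)) *\<^sub>R x $ i $ j) has_vector_derivative
      (exp (t * (a i - a j)) * (a i - a j)) *\<^sub>R x $ i $ j) (at t)"
    by (auto intro!: derivative_eq_intros)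
  moreover have "(d ** Y t - Y t ** d) $ i $ j = (exp (t * (a i - a j)) * (a i - a j)) *\<^sub>R x $ i $ j"
    by (simp add: d_def Y_def flow_def mat_def scaleR_conv_of_real algebra_simps)
  ultimately show "((\<lambda>s. Y s $ i $ j) has_vector_derivative (d ** Y t - Y t ** d) $ i $ j) (at t)"
    by (simp add: Y_def flow_def scaleR_conv_of_real)
qed

text \<open>At a strict drop the first \<open>k\<close> indices form a superlevel set of
  \<open>l\<close>, so elements of \<open>B\<close> preserve the range of
  \<open>D k\<close>.\<close>

lemma gap_threshold:
  assumes k: "k \<in> {1..<CARD('n)}" and gap_k: "lam (k + 1) < lam k"
  shows "idx i \<le> k \<longleftrightarrow> lam k \<le> l i"
proof
  assume "idx i \<le> k"
  then show "lam k \<le> l i"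
    using lam_dec k idx_bounds[of i] by (auto simp: monotone_on_def l_def)
next
  assume le: "lam k \<le> l i"
  show "idx i \<le> k"
  proof (rule ccontr)
    assume "\<not> idx i \<le> k"
    then have "l i \<le> lam (k + 1)"
      using lam_dec k idx_bounds[of i] by (auto simp: monotone_on_def l_def)
    then show False
      using le gap_k by simp
  qed
qed

lemma D_block:
  assumes "k \<in> {1..<CARD('n)}" "lam (k + 1) < lam k" "b \<in> B"
  shows "b ** D k = D k ** b ** D k"
  using assms(3) unfolding D_def gap_threshold[OF assms(1,2)] B_threshold by (rule spec)

lemma D_idem: "D k ** D k = D k"
  by (auto simp: D_def dg_mult_dg intro!: arg_cong[of _ _ dg])

lemma D_herm: "(D k)\<^sup>\<dagger> = D k"
  by (auto simp: D_def conj_transpose_dg intro!: arg_cong[of _ _ dg])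

lemma A_herm: "A\<^sup>\<dagger> = A"
  by (simp add: A_def cj_conj_transpose conj_transpose_dg)

text \<open>The chosen unitaries \<open>U s\<close> may jump with s, so they are never
  differentiated. At a strict drop \<open>cj (U s) (D k)\<close> is the orthogonal projection onto
  the range of the smooth \<open>M s\<close>, and its derivative turns out to be
  \<open>compress\<close>.\<close>

lemma chart_flow_has_vector_derivative:
  assumes x: "x \<in> E"
  shows "((\<lambda>t. chart (flow t x)) has_vector_derivative kahler_grad (trace_fun N) (chart (flow t x))) (at t)"
proof -
  have "\<forall>s. \<exists>U b. U \<in> unitary_group \<and> b \<in> B \<and> g ** (mat 1 + flow s x) = U ** b \<and> chart (flow s x) = orbit_pt l U"
    using chart_rel_chart[OF flow_mem_E[OF x]] unfolding chart_rel_def by blast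
  then obtain U b where U: "\<And>s. U s \<in> unitary_group" and b: "\<And>s. b s \<in> B"
    and Ub: "\<And>s. g ** (mat 1 + flow s x) = U s ** b s" and L: "\<And>s. chart (flow s x) = orbit_pt l (U s)"
    by metis
  obtain y where y: "y ** (mat 1 + x) = mat 1"
    using unipotent_invertible[OF x] by (rule exE)
  \<comment> \<open>A left inverse of \<open>g ** (mat 1 + flow s x)\<close> that is continuous in
    s, got by conjugating the inverse \<open>y\<close> at time 0.\<close>
  define C where "C s = diag_exp s ** y ** diag_exp (- s) ** g\<^sup>\<dagger>" for s
  have CG: "C s ** (g ** (mat 1 + flow s x)) = mat 1" for s
  proof -
    have "C s ** (g ** (mat 1 + flow s x))
        = diag_exp s ** y ** (diag_exp (- s) ** (g\<^sup>\<dagger> ** g) ** diag_exp s) ** (mat 1 + x) ** diag_exp (- s)"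
      by (simp only: C_def one_plus_flow matrix_mul_assoc)
    also have "\<dots> = diag_exp s ** y ** (mat 1 + x) ** diag_exp (- s)"
      using g diag_exp_inverse[of "- s"] by (simp add: unitary_cancel)
    also have "\<dots> = diag_exp s ** (y ** (mat 1 + x)) ** diag_exp (- s)"
      by (simp only: matrix_mul_assoc)
    also have "\<dots> = mat 1"
      by (simp add: y diag_exp_inverse)
    finally show ?thesis .
  qed
  have Cb: "b s ** (C s ** U s) = mat 1" for s
  proof -
    have "(C s ** U s) ** b s = mat 1"
      using CG[of s] by (simp add: Ub matrix_mul_assoc)
    then show "b s ** (C s ** U s) = mat 1"
      using matrix_left_right_inverse by blast
  qed
  have C_lim: "(C \<longlongrightarrow> C t) (at t)"
    unfolding C_def using tendsto_diag_exp[of 1 t] tendsto_diag_exp[of "- 1" t]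
    by (intro tendsto_intros) simp_all
  have P_deriv: "((\<lambda>s. cj (U s) (D k)) has_vector_derivative compress (cj (U t) (D k))) (at t)"
    if k: "k \<in> {1..<CARD('n)}" "lam (k + 1) < lam k" for k
  proof -
    define P where "P s = cj (U s) (D k)" for s
    define M where "M s = g ** (mat 1 + flow s x) ** D k" for s
    define d :: "'n cmat" where "d = dg (\<lambda>i. of_real (a i))"
    have herm: "(P s)\<^sup>\<dagger> = P s" for s
      by (simp add: P_def cj_conj_transpose D_herm)
    have PM: "P s ** M s = M s" for s
    proof -
      have "P s ** M s = U s ** (D k ** b s ** D k)"
        using U by (simp add: P_def M_def Ub cj_def matrix_mul_assoc unitary_cancel)
      also have "\<dots> = M s"
        by (simp add: D_block[OF k b, symmetric] M_def Ub matrix_mul_assoc)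
      finally show ?thesis .
    qed
    have MCP: "M s ** C s ** P s = P s" for s
    proof -
      let ?c = "C s ** U s"
      have c: "?c \<in> B"
        using B_inverse[OF b Cb] .
      have "M s ** C s ** P s = U s ** b s ** (D k ** ?c ** D k) ** (U s)\<^sup>\<dagger>"
        by (simp add: M_def Ub P_def cj_def matrix_mul_assoc)
      also have "\<dots> = U s ** (b s ** ?c) ** D k ** (U s)\<^sup>\<dagger>"
        unfolding D_block[OF k c, symmetric] by (simp only: matrix_mul_assoc)
      also have "\<dots> = P s"
        by (simp add: Cb P_def cj_def)
      finally show ?thesis .
    qed
    have "((\<lambda>s. g ** (mat 1 + flow s x) ** D k) has_vector_derivative
        g ** (d ** (mat 1 + flow t x) - (mat 1 + flow t x) ** d) ** D k) (at t)"
      unfolding d_def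
      by (intro bounded_linear.has_vector_derivative[OF bounded_bilinear.bounded_linear_left[OF bounded_bilinear_matrix_mult]]
          bounded_linear.has_vector_derivative[OF bounded_bilinear.bounded_linear_right[OF bounded_bilinear_matrix_mult]]
          one_plus_flow_has_vector_derivative)
    moreover have "g ** (d ** (mat 1 + flow t x) - (mat 1 + flow t x) ** d) ** D k = A ** M t - M t ** d"
    proof -
      have "g ** d = A ** g"
        using g by (simp add: A_def cj_def d_def unitary_cancel)
      moreover have "d ** D k = D k ** d"
        by (simp add: d_def D_def dg_mult_dg mult.commute)
      ultimately show ?thesis
        by (simp add: M_def matrix_mult_diff_left matrix_mult_diff_right matrix_mul_assoc)
          (simp flip: matrix_mul_assoc)
    qed
    ultimately have M_deriv: "(M has_vector_derivative A ** M t - M t ** d) (at t)"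
      by (simp add: M_def[abs_def])
    define Z where "Z = (mat 1 - P t) ** (A ** M t - M t ** d) ** C t ** P t"
    have "(P has_vector_derivative Z + Z\<^sup>\<dagger>) (at t)"
      unfolding Z_def
    proof (rule projection_has_vector_derivative[OF herm _ PM MCP C_lim M_deriv])
      show "norm (P s) \<le> norm (D k)" for s
        using U by (simp add: P_def norm_cj)
    qed
    \<comment> \<open>The columns of \<open>M t ** d\<close> stay in the range of
      \<open>P t\<close>, so \<open>mat 1 - P t\<close> kills them and only \<open>A\<close>
      remains.\<close>
    moreover have "Z = A ** P t - P t ** A ** P t"
    proof -
      have "Z = (mat 1 - P t) ** A ** (M t ** C t ** P t) - (M t - P t ** M t) ** d ** C t ** P t"
        by (simp add: Z_def matrix_mult_diff_left matrix_mult_diff_right matrix_mul_assoc)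
      also have "\<dots> = (mat 1 - P t) ** A ** P t - 0 ** d ** C t ** P t"
        by (simp only: MCP PM diff_self)
      also have "0 ** d ** C t ** P t = 0"
        by (simp add: vec_eq_iff mult_nth)
      finally show ?thesis
        by (simp add: matrix_mult_diff_left)
    qed
    moreover have "A ** P t - P t ** A ** P t + (A ** P t - P t ** A ** P t)\<^sup>\<dagger> = compress (P t)"
      by (simp add: conj_transpose_diff conj_transpose_mult herm A_herm compress_def scaleR_2 matrix_mul_assoc)
    ultimately show ?thesis
      by (simp add: P_def[abs_def])
  qed
  have "((\<lambda>s. cscale (\<i> * of_real (w k)) (cj (U s) (D k))) has_vector_derivative
      cscale (\<i> * of_real (w k)) (compress (cj (U t) (D k)))) (at t)" if k: "k \<in> {1..<CARD('n)}" for k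
  proof (cases "lam (k + 1) < lam k")
    case True
    show ?thesis
      by (rule bounded_linear.has_vector_derivative[OF _ P_deriv[OF k True]])
        (simp add: linear_cscale linear_linear)
  next
    case False
    \<comment> \<open>Here the projection may depend discontinuously on s, but its weight in the sum
      is zero.\<close>
    then have "w k = 0"
      using w_nonneg[OF k] by (simp add: w_def)
    moreover have "cscale 0 X = 0" for X :: "'n cmat"
      by (simp add: vec_eq_iff)
    ultimately show ?thesis
      by simp
  qed
  then have "((\<lambda>s. orbit_pt l (U s)) has_vector_derivative
      (\<Sum>k\<in>{1..<CARD('n)}. cscale (\<i> * of_real (w k)) (compress (cj (U t) (D k)))) + 0) (at t)"
    unfolding orbit_pt_eq_sum[OF U]
    by (intro has_vector_derivative_add has_vector_derivative_sum has_vector_derivative_const)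
  then show ?thesis
    unfolding L kahler_grad_eq[OF U] by simp
qed

lemma kahler_flow_chart:
  assumes "x \<in> E"
  shows "kahler_flow lam (trace_fun N) (\<lambda>t. chart (flow t x))"
  unfolding kahler_flow_def
  using chart_flow_has_vector_derivative[OF assms] chart_in_orbit[OF flow_mem_E[OF assms]] by blast

section \<open>Contraction rates and the attractor\<close>

lemma mu_antimono: "\<lbrakk>i \<le> j; 1 \<le> i; j \<le> CARD('n)\<rbrakk> \<Longrightarrow> mu j \<le> mu i"
  using mu_dec by (auto simp: monotone_on_def)

text \<open>Between two positions with different values of \<open>lam\<close> some consecutive pair
  drops strictly; \<open>gap\<close> makes \<open>mu\<close> drop there too, and monotonicity
  spreads this to both ends. All rates on \<open>E\<close> are therefore contracting.\<close>

lemma weight_pos: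
  assumes "l i < l j"
  shows "a i < a j"
proof -
  have "\<exists>k\<in>{1..<CARD('n)}. lam (k + 1) < lam k \<and> idx j \<le> k \<and> k < idx i"
  proof (rule ccontr)
    assume *: "\<not> ?thesis"
    have "lam m = lam (idx j)" if "idx j \<le> m" "m \<le> idx i" for m
      using that
    proof (induction m rule: dec_induct)
      case (step m)
      then have "m \<in> {1..<CARD('n)}"
        using idx_bounds[of j] idx_bounds[of i] by simp
      then have "\<not> lam (m + 1) < lam m"
        using * step by auto
      then have "w m = 0"
        using w_nonneg[OF \<open>m \<in> _\<close>] by (simp add: w_def)
      then show ?case
        using step by (simp add: w_def)
    qed simp
    from this[of "idx i"] show False
      using assms less_imp_le[OF idx_strict_mono[OF l_less_imp[OF assms]]] by (simp add: l_def)
  qed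
  then obtain k where k: "k \<in> {1..<CARD('n)}" "lam (k + 1) < lam k" "idx j \<le> k" "k < idx i"
    by blast
  have "mu (idx i) \<le> mu (k + 1)" "mu k \<le> mu (idx j)"
    using k idx_bounds[of i] idx_bounds[of j] by (auto intro: mu_antimono)
  then show ?thesis
    using gap[OF k(1,2)] by (simp add: a_def divide_strict_right_mono)
qed

text \<open>The strict drop of \<open>mu\<close> after \<open>k\<close> separates the first
  \<open>k\<close> eigenvalues from all later ones, whatever repetitions there are on either side.
  An eigenvector in question thus has no components beyond position \<open>k\<close> in the basis
  \<open>g\<close>.\<close>

lemma top_eigenspace_eq:
  assumes k: "k \<in> {1..<CARD('n)}" and gap_k: "lam (k + 1) < lam k"
  shows "top_eigenspace mu N k = {v. cj g (D k) *v v = v}"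
proof -
  let ?P = "cj g (D k)" and ?\<mu> = "dg (\<lambda>i. of_real (mu (idx i))) :: 'n cmat"
  have D: "(D k *v u) $ i = (if idx i \<le> k then u $ i else 0)" for u i
    by (simp add: D_def matrix_vector_nth dg_nth if_distrib[of "\<lambda>x. x * _"] cong: if_cong)
  have mu_v: "(?\<mu> *v u) $ i = of_real (mu (idx i)) * u $ i" for u i
    by (simp add: matrix_vector_nth dg_nth if_distrib[of "\<lambda>x. x * _"] cong: if_cong)
  have P_iff: "?P *v v = v \<longleftrightarrow> D k *v (g\<^sup>\<dagger> *v v) = g\<^sup>\<dagger> *v v" for v
  proof
    assume "?P *v v = v"
    then have "g\<^sup>\<dagger> *v (?P *v v) = g\<^sup>\<dagger> *v v"
      by simp
    then show "D k *v (g\<^sup>\<dagger> *v v) = g\<^sup>\<dagger> *v v"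
      using g by (simp add: cj_def matrix_vector_mul_assoc matrix_mul_assoc unitary_cancel)
  next
    assume "D k *v (g\<^sup>\<dagger> *v v) = g\<^sup>\<dagger> *v v"
    then have "g *v (D k *v (g\<^sup>\<dagger> *v v)) = g *v (g\<^sup>\<dagger> *v v)"
      by simp
    then show "?P *v v = v"
      using g by (simp add: cj_def matrix_vector_mul_assoc matrix_mul_assoc unitary_cancel)
  qed
  let ?X = "{v. \<exists>j\<in>{1..k}. cscale \<i> N *v v = complex_of_real (mu j) *s v}"
  have "vec.span ?X \<subseteq> {v. ?P *v v = v}"
  proof (rule vec.span_minimal)
    show "vec.subspace {v. ?P *v v = v}"
      by (auto simp: vec.subspace_def matrix_vector_right_distrib vector_scalar_commute)
    show "?X \<subseteq> {v. ?P *v v = v}"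
    proof (intro subsetI CollectI, elim CollectE bexE)
      fix v j assume j: "j \<in> {1..k}" and v: "cscale \<i> N *v v = complex_of_real (mu j) *s v"
      have "g\<^sup>\<dagger> *v (cscale \<i> N *v v) = complex_of_real (mu j) *s (g\<^sup>\<dagger> *v v)"
        by (simp add: v vector_scalar_commute)
      then have eig: "?\<mu> *v (g\<^sup>\<dagger> *v v) = complex_of_real (mu j) *s (g\<^sup>\<dagger> *v v)"
        using g by (simp add: N_eq cj_def matrix_vector_mul_assoc matrix_mul_assoc unitary_cancel)
      have "(g\<^sup>\<dagger> *v v) $ i = 0" if "\<not> idx i \<le> k" for i
      proof -
        have "mu (idx i) \<le> mu (k + 1)" "mu k \<le> mu j"
          using that j k idx_bounds[of i] by (auto intro: mu_antimono)
        then have "mu (idx i) \<noteq> mu j"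
          using gap[OF k gap_k] by simp
        moreover have "of_real (mu (idx i)) * (g\<^sup>\<dagger> *v v) $ i = of_real (mu j) * (g\<^sup>\<dagger> *v v) $ i"
          using arg_cong[OF eig, of "\<lambda>u. u $ i"] by (simp only: mu_v vector_smult_component)
        ultimately show ?thesis
          by simp
      qed
      then have "D k *v (g\<^sup>\<dagger> *v v) = g\<^sup>\<dagger> *v v"
        unfolding vec_eq_iff D by simp
      then show "?P *v v = v"
        by (simp only: P_iff)
    qed
  qed
  moreover have "{v. ?P *v v = v} \<subseteq> vec.span ?X"
  proof (intro subsetI, elim CollectE)
    fix v assume "?P *v v = v"
    then have u: "D k *v (g\<^sup>\<dagger> *v v) = g\<^sup>\<dagger> *v v"
      by (simp add: P_iff)
    define u where "u = g\<^sup>\<dagger> *v v"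
    have u0: "u $ i = 0" if "\<not> idx i \<le> k" for i
      using arg_cong[OF u, of "\<lambda>x. x $ i"] that by (simp add: D u_def)
    have "v = g *v u"
      using g by (simp add: u_def matrix_vector_mul_assoc unitary_cancel)
    also have "\<dots> = (\<Sum>i\<in>UNIV. u $ i *s (g *v axis i 1))"
      by (simp add: vec_eq_iff matrix_vector_nth axis_def if_distrib[of "\<lambda>x. _ * x"] mult.commute cong: if_cong)
    also have "\<dots> \<in> vec.span ?X"
    proof (rule vec.span_sum)
      fix i
      show "u $ i *s (g *v axis i 1) \<in> vec.span ?X"
      proof (cases "idx i \<le> k")
        case True
        have "?\<mu> *v axis i 1 = complex_of_real (mu (idx i)) *s axis i 1"
          by (simp only: vec_eq_iff mu_v vector_smult_component) (simp add: axis_def)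
        then have "g *v (?\<mu> *v axis i 1) = complex_of_real (mu (idx i)) *s (g *v axis i 1)"
          by (simp add: vector_scalar_commute)
        then have "cscale \<i> N *v (g *v axis i 1) = complex_of_real (mu (idx i)) *s (g *v axis i 1)"
          using g by (simp add: N_eq cj_def matrix_vector_mul_assoc unitary_cancel)
        then have "g *v axis i 1 \<in> ?X"
          using True idx_bounds[of i] by auto
        then show ?thesis
          by (intro vec.span_scale vec.span_base)
      next
        case False
        then show ?thesis
          by (simp add: u0 vec.span_zero)
      qed
    qed
    finally show "v \<in> vec.span ?X" .
  qed
  ultimately show ?thesis
    unfolding top_eigenspace_def by (rule equalityI)
qed

lemma orth_proj_fixed_space:
  fixes P :: "'n cmat"
  assumes herm: "P\<^sup>\<dagger> = P" and idem: "P ** P = P"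
  shows "orth_proj {v. P *v v = v} = P"
  unfolding orth_proj_def
proof (rule the_equality)
  have adj: "herm_inner x (P *v y) = herm_inner (P *v x) y" for x y
    using arg_cong[OF adjoint_matrix_vector[of y P x], of cnj] 
      adjoint_matrix_vector[of y P x]
    by (simp add: herm herm_inner_def mult.commute)
  show "\<forall>v. P *v v \<in> {v. P *v v = v} \<and> (\<forall>w\<in>{v. P *v v = v}. herm_inner (v - P *v v) w = 0)"
  proof (intro allI conjI ballI)
    fix v
    show "P *v v \<in> {v. P *v v = v}"
      by (simp add: matrix_vector_mul_assoc idem)
    fix w assume "w \<in> {v. P *v v = v}"
    then have "herm_inner (v - P *v v) w = herm_inner (P *v (v - P *v v)) w"
      using adj[of "v - P *v v" w] by simp
    also have "P *v (v - P *v v) = 0"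
      by (simp add: matrix_vector_mult_diff_distrib matrix_vector_mul_assoc idem)
    finally show "herm_inner (v - P *v v) w = 0"
      by (simp add: herm_inner_def)
  qed
  then have orthP: "herm_inner (v - P *v v) w = 0" if "P *v w = w" for v w
    using that by blast
  fix Q assume Q: "\<forall>v. Q *v v \<in> {v. P *v v = v} \<and> (\<forall>w\<in>{v. P *v v = v}. herm_inner (v - Q *v v) w = 0)"
  have "Q *v v = P *v v" for v
  proof -
    let ?d = "Q *v v - P *v v"
    have d: "P *v ?d = ?d"
      using Q by (simp add: matrix_vector_mult_diff_distrib matrix_vector_mul_assoc idem)
    have "herm_inner ?d ?d = herm_inner (v - P *v v) ?d - herm_inner (v - Q *v v) ?d"
      by (simp add: herm_inner_def algebra_simps sum_subtractf sum.distrib)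
    also have "\<dots> = 0"
      using orthP[OF d, of v] Q d by simp
    finally have "of_real ((norm ?d)\<^sup>2) = (0 :: complex)"
      unfolding sum_cnj_mult_self[symmetric] by (simp only: herm_inner_def mult.commute)
    then show ?thesis
      by simp
  qed
  then show "Q = P"
    by (simp add: matrix_eq)
qed

text \<open>The origin of the chart is the point diagonalized by \<open>g\<close> itself; in its
  expansion by projections the positions without a drop have weight zero.\<close>

lemma attractor_eq: "attractor lam mu N = chart 0"
proof -
  have "(mat 1 :: 'n cmat) \<in> B"
    by (auto simp: B_def mat_def)
  moreover have "g ** (mat 1 + 0) = g ** mat 1"
    by simp
  ultimately have "chart_rel 0 (orbit_pt l g)"
    unfolding chart_rel_def using g subspace_0[OF subspace_E] by blast
  then have "chart 0 = orbit_pt l g"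
    by (simp add: chart_rel_iff)
  also have "\<dots> = (\<Sum>k\<in>{1..<CARD('n)}. cscale (\<i> * of_real (w k)) (cj g (D k)))
      + cscale (\<i> * of_real (lam CARD('n))) (mat 1)"
    by (rule orbit_pt_eq_sum[OF g])
  also have "(\<Sum>k\<in>{1..<CARD('n)}. cscale (\<i> * of_real (w k)) (cj g (D k)))
      = (\<Sum>k\<in>{k\<in>{1..<CARD('n)}. lam k > lam (k + 1)}.
          cscale (complex_of_real (lam k - lam (k + 1)) * \<i>) (orth_proj (top_eigenspace mu N k)))"
  proof (rule sum.mono_neutral_cong_right)
    show "\<forall>k\<in>{1..<CARD('n)} - {k\<in>{1..<CARD('n)}. lam k > lam (k + 1)}.
        cscale (\<i> * of_real (w k)) (cj g (D k)) = 0"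
    proof
      fix k assume k: "k \<in> {1..<CARD('n)} - {k\<in>{1..<CARD('n)}. lam k > lam (k + 1)}"
      then have "w k = 0"
        using w_nonneg[of k] by (auto simp: w_def)
      then show "cscale (\<i> * of_real (w k)) (cj g (D k)) = 0"
        by (simp add: vec_eq_iff)
    qed
    fix k assume "k \<in> {k\<in>{1..<CARD('n)}. lam k > lam (k + 1)}"
    then have k: "k \<in> {1..<CARD('n)}" "lam (k + 1) < lam k"
      by auto
    have "orth_proj (top_eigenspace mu N k) = cj g (D k)"
      unfolding top_eigenspace_eq[OF k]
      by (rule orth_proj_fixed_space) (simp_all add: cj_conj_transpose D_herm cj_mult[OF g] D_idem)
    then show "cscale (\<i> * of_real (w k)) (cj g (D k))
        = cscale (complex_of_real (lam k - lam (k + 1)) * \<i>) (orth_proj (top_eigenspace mu N k))"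
      by (simp add: w_def mult.commute)
  qed auto
  finally show ?thesis
    unfolding attractor_def by (simp add: mult.commute)
qed

end

section \<open>From a starlike set to balls\<close>

lemma homeomorphic_imp_homeomorphic_space:
  assumes "S homeomorphic T"
  shows "top_of_set S homeomorphic_space top_of_set T"
proof -
  obtain f g where "homeomorphism S T f g"
    using assms unfolding homeomorphic_def by (elim exE)
  then have "homeomorphic_maps (top_of_set S) (top_of_set T) f g"
    by (auto simp: homeomorphic_maps_def homeomorphism_def)
  then show ?thesis
    by (rule homeomorphic_maps_imp_homeomorphic_space)
qed

text \<open>Coordinates in an orthonormal basis: since they preserve the norm, one map serves closed
  ball, open ball and sphere.\<close>

lemma subspace_isometric_Euclidean_space:
  fixes V :: "'a::euclidean_space set"
  assumes V: "subspace V"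
  obtains h where "homeomorphic_map (top_of_set V) (Euclidean_space (dim V)) h"
    "\<And>x. x \<in> V \<Longrightarrow> (\<Sum>i<dim V. (h x i)\<^sup>2) = (norm x)\<^sup>2"
proof -
  obtain Bs where Bs: "Bs \<subseteq> V" "pairwise orthogonal Bs" "\<And>x. x \<in> Bs \<Longrightarrow> norm x = 1"
      "independent Bs" "card Bs = dim V" "span Bs = V"
    using orthonormal_basis_subspace[OF V] by metis
  let ?d = "dim V"
  have "finite Bs"
    using Bs(4) by (rule independent_imp_finite)
  then obtain b where b: "bij_betw b {..<?d} Bs"
    using ex_bij_betw_nat_finite[of Bs] Bs(5) by (auto simp: atLeast0LessThan)
  have bb: "b i \<bullet> b j = (if i = j then 1 else 0)" if "i < ?d" "j < ?d" for i j
  proof (cases "i = j")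
    case True
    have "norm (b i) = 1"
      using Bs(3) bij_betwE[OF b] that by simp
    then show ?thesis
      using True by (simp add: dot_square_norm)
  next
    case False
    then have "b i \<noteq> b j"
      using b that by (auto simp: bij_betw_def inj_on_def)
    then have "orthogonal (b i) (b j)"
      using Bs(2) bij_betwE[OF b] that by (auto simp: pairwise_def)
    then show ?thesis
      using False by (simp add: orthogonal_def)
  qed
  have coord: "(\<Sum>i<?d. y i *\<^sub>R b i) \<bullet> b j = y j" if "j < ?d" for y j
  proof -
    have "(\<Sum>i<?d. y i *\<^sub>R b i) \<bullet> b j = (\<Sum>i<?d. if i = j then y i else 0)"
      unfolding inner_sum_left using bb that by (intro sum.cong) auto
    then show ?thesis
      using that by simp
  qed
  have expand: "x = (\<Sum>i<?d. (x \<bullet> b i) *\<^sub>R b i)" if "x \<in> V" for x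
  proof -
    have "x \<in> span Bs"
      using that Bs(6) by simp
    then obtain u where "x = (\<Sum>v\<in>Bs. u v *\<^sub>R v)"
      using span_finite[OF \<open>finite Bs\<close>] by auto
    also have "\<dots> = (\<Sum>i<?d. u (b i) *\<^sub>R b i)"
      by (rule sum.reindex_bij_betw[OF b, symmetric])
    finally have x: "x = (\<Sum>i<?d. u (b i) *\<^sub>R b i)" .
    show ?thesis
      using coord[of _ "\<lambda>i. u (b i)"] by (subst x) (simp flip: x)
  qed
  define h where "h x = (\<lambda>i. if i < ?d then x \<bullet> b i else 0)" for x
  define k where "k y = (\<Sum>i<?d. y i *\<^sub>R b i)" for y
  have "homeomorphic_maps (top_of_set V) (Euclidean_space ?d) h k"
    unfolding homeomorphic_maps_def
  proof (intro conjI ballI)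
    show "continuous_map (top_of_set V) (Euclidean_space ?d) h"
      unfolding h_def continuous_map_componentwise_Euclidean_space
      by (auto intro!: continuous_intros)
    have "continuous_on (topspace (Euclidean_space ?d)) k"
      unfolding k_def
      by (intro continuous_intros continuous_on_subset[OF continuous_on_product_coordinates] subset_UNIV)
    moreover have "k y \<in> V" for y
      unfolding k_def using Bs(1) bij_betwE[OF b] V by (auto intro!: subspace_sum subspace_scale)
    ultimately show "continuous_map (Euclidean_space ?d) (top_of_set V) k"
      by (auto simp: continuous_map_in_subtopology continuous_map_Euclidean_space_iff)
    show "k (h x) = x" if "x \<in> topspace (top_of_set V)" for x
      using expand[of x] that by (simp add: h_def k_def)
    show "h (k y) = y" if "y \<in> topspace (Euclidean_space ?d)" for y
      using that coord by (auto simp: h_def k_def topspace_Euclidean_space)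
  qed
  then have "homeomorphic_map (top_of_set V) (Euclidean_space ?d) h"
    using homeomorphic_map_maps by blast
  moreover have "(\<Sum>i<?d. (h x i)\<^sup>2) = (norm x)\<^sup>2" if "x \<in> V" for x
  proof -
    have "(norm x)\<^sup>2 = x \<bullet> (\<Sum>i<?d. (x \<bullet> b i) *\<^sub>R b i)"
      using expand[OF that] by (simp add: power2_norm_eq_inner)
    then show ?thesis
      by (simp add: inner_sum_right h_def power2_eq_square)
  qed
  ultimately show thesis
    by (rule that)
qed

lemma unit_balls_homeomorphic_std:
  fixes V :: "'a::euclidean_space set"
  assumes V: "subspace V"
  shows "top_of_set (cball 0 1 \<inter> V) homeomorphic_space std_cball (dim V)"
    "top_of_set (ball 0 1 \<inter> V) homeomorphic_space std_ball (dim V)"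
    "top_of_set (sphere 0 1 \<inter> V) homeomorphic_space std_sphere (dim V)"
proof -
  obtain h where h: "homeomorphic_map (top_of_set V) (Euclidean_space (dim V)) h"
    and norm: "\<And>x. x \<in> V \<Longrightarrow> (\<Sum>i<dim V. (h x i)\<^sup>2) = (norm x)\<^sup>2"
    using subspace_isometric_Euclidean_space[OF V] by metis
  have sub: "top_of_set (S \<inter> V) homeomorphic_space subtopology (Euclidean_space (dim V)) T"
    if "\<And>x. x \<in> V \<Longrightarrow> h x \<in> T \<longleftrightarrow> x \<in> S" for S T
  proof -
    have "homeomorphic_map (subtopology (top_of_set V) S) (subtopology (Euclidean_space (dim V)) T) h"
      using h that by (intro homeomorphic_map_subtopologies_alt) auto
    then show ?thesis
      by (simp add: subtopology_subtopology Int_commute homeomorphic_map_imp_homeomorphic_space)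
  qed
  show "top_of_set (cball 0 1 \<inter> V) homeomorphic_space std_cball (dim V)"
    unfolding std_cball_def by (rule sub) (simp add: norm power_le_one_iff abs_square_le_1)
  show "top_of_set (ball 0 1 \<inter> V) homeomorphic_space std_ball (dim V)"
    unfolding std_ball_def by (rule sub) (simp add: norm abs_square_less_1)
  show "top_of_set (sphere 0 1 \<inter> V) homeomorphic_space std_sphere (dim V)"
    unfolding std_sphere_def
  proof (rule sub)
    fix x assume "x \<in> V"
    moreover have "norm x \<noteq> - 1"
      using norm_ge_zero[of x] by linarith
    ultimately show "h x \<in> {y. (\<Sum>i<dim V. (y i)\<^sup>2) = 1} \<longleftrightarrow> x \<in> sphere 0 1"
      by (simp add: norm power2_eq_1_iff)
  qed
qed

text \<open>The scaling hypothesis identifies \<open>I\<close> with the relative interior of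
  \<open>K\<close> and places every open segment from 0 to a point of \<open>K\<close> inside it.
  Radial projection then handles \<open>K\<close> and \<open>K - I\<close>, and a homeomorphism from
  \<open>K\<close> to the ball respects relative interiors.\<close>

lemma starlike_homeomorphic_balls:
  fixes V :: "'a::euclidean_space set"
  assumes V: "subspace V" and KV: "K \<subseteq> V" and comp: "compact K" and ne: "K \<noteq> {}"
    and open_I: "openin (top_of_set V) I" and IK: "I \<subseteq> K"
    and star: "\<And>x s. x \<in> K \<Longrightarrow> 0 < s \<Longrightarrow> s < 1 \<Longrightarrow> s *\<^sub>R x \<in> I"
  shows "top_of_set K homeomorphic_space std_cball (dim V)"
    "top_of_set I homeomorphic_space std_ball (dim V)"
    "top_of_set (K - I) homeomorphic_space std_sphere (dim V)"
proof -
  obtain x0 where x0: "x0 \<in> K"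
    using ne by blast
  \<comment> \<open>The origin is a limit of contracted copies of \<open>x0\<close>, hence in the
    closed \<open>K\<close>; scaling it by 1/2 then puts it into \<open>I\<close>.\<close>
  have "((\<lambda>s. s *\<^sub>R x0) \<longlongrightarrow> 0 *\<^sub>R x0) (at_right 0)"
    by (intro tendsto_intros)
  moreover have "\<forall>\<^sub>F s in at_right 0. s *\<^sub>R x0 \<in> K"
    unfolding eventually_at_right_field using star[OF x0] IK by (intro exI[of _ 1]) auto
  ultimately have "0 \<in> K"
    using compact_imp_closed[OF comp] by (metis Lim_in_closed_set scaleR_zero_left trivial_limit_at_right_real)
  then have I0: "0 \<in> I"
    using star[of 0 "1/2"] by simp
  have aff: "affine hull K = V"
  proof
    show "affine hull K \<subseteq> V"
      using KV V by (simp add: hull_minimal subspace_imp_affine)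
    have hull_V: "affine hull V = V"
      using V by (simp add: affine_hull_eq subspace_imp_affine)
    have "affine hull I = affine hull V"
      using open_I I0 by (intro affine_hull_openin) (auto simp only: hull_V)
    then show "V \<subseteq> affine hull K"
      using hull_mono[OF IK, of affine] hull_subset[of V affine] by blast
  qed
  have rel: "rel_interior K = I"
  proof
    show "I \<subseteq> rel_interior K"
      using IK open_I by (intro rel_interior_maximal) (simp_all add: aff)
    show "rel_interior K \<subseteq> I"
    proof
      fix y assume y: "y \<in> rel_interior K"
      then obtain e where e: "e > 0" "ball y e \<inter> V \<subseteq> K"
        by (auto simp: mem_rel_interior_ball aff)
      \<comment> \<open>A dilation just above 1 that moves \<open>y\<close> by less than e, also for
        \<open>y\<close> = 0; contracting \<open>r *\<^sub>R y\<close> back to \<open>y\<close> then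
        lands in \<open>I\<close>.\<close>
      define r where "r = 1 + e / (2 * norm y + 2)"
      have r: "r > 1"
        using e by (simp add: r_def add_nonneg_pos)
      have "dist y (r *\<^sub>R y) = (r - 1) * norm y"
      proof -
        have "y - r *\<^sub>R y = (1 - r) *\<^sub>R y"
          by (simp add: scaleR_diff_left)
        then show ?thesis
          using r by (simp add: dist_norm)
      qed
      also have "\<dots> < e"
      proof -
        have "norm y < 2 * norm y + 2"
          using norm_ge_zero[of y] by linarith
        then have "e * norm y < e * (2 * norm y + 2)"
          using e(1) by (rule mult_strict_left_mono)
        moreover have "0 < 2 * norm y + 2"
          using norm_ge_zero[of y] by linarith
        ultimately show ?thesis
          by (simp add: r_def pos_divide_less_eq)
      qed
      finally have "r *\<^sub>R y \<in> ball y e"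
        by simp
      moreover have "y \<in> V"
        using y rel_interior_subset KV by blast
      then have "r *\<^sub>R y \<in> V"
        using V by (simp add: subspace_scale)
      ultimately have "r *\<^sub>R y \<in> K"
        using e by blast
      then have "(1 / r) *\<^sub>R (r *\<^sub>R y) \<in> I"
        using r by (intro star) auto
      then show "y \<in> I"
        using r by simp
    qed
  qed
  have seg: "open_segment 0 x \<subseteq> rel_interior K" if "x \<in> K" for x
    using star[OF that] by (auto simp: rel in_segment)
  have K: "K homeomorphic cball 0 1 \<inter> V"
    using starlike_compact_projective2_0[OF comp _ seg] I0 by (simp add: rel aff)
  have bd: "K - I homeomorphic sphere 0 1 \<inter> V"
    using starlike_compact_projective1_0[OF comp _ seg] I0 by (simp add: rel aff)
  have zero: "0 \<in> ball 0 1 \<inter> V"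
    using subspace_0[OF V] by simp
  have rel_cball: "rel_interior (cball (0::'a) 1) = ball 0 1"
    by (subst rel_interior_nonempty_interior) (auto simp: set_eq_iff intro!: exI[of _ 0])
  have rel_ball: "rel_interior (cball (0::'a) 1 \<inter> V) = ball 0 1 \<inter> V"
    unfolding rel_cball[symmetric]
  proof (rule convex_affine_rel_interior_Int)
    show "rel_interior (cball 0 1) \<inter> V \<noteq> {}"
      unfolding rel_cball using zero by (metis empty_iff)
  qed (use V in \<open>simp_all add: subspace_imp_affine\<close>)
  have "rel_interior K homeomorphic rel_interior (cball 0 1 \<inter> V)"
  proof (rule homeomorphic_rel_interiors[OF K])
    show "rel_interior K = {} \<longleftrightarrow> rel_interior (cball 0 1 \<inter> V) = {}"
      unfolding rel rel_ball using I0 zero by (metis empty_iff)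
  qed
  then have I: "I homeomorphic ball 0 1 \<inter> V"
    unfolding rel rel_ball .
  show "top_of_set K homeomorphic_space std_cball (dim V)"
    using homeomorphic_imp_homeomorphic_space[OF K] unit_balls_homeomorphic_std(1)[OF V]
    by (rule homeomorphic_space_trans)
  show "top_of_set I homeomorphic_space std_ball (dim V)"
    using homeomorphic_imp_homeomorphic_space[OF I] unit_balls_homeomorphic_std(2)[OF V]
    by (rule homeomorphic_space_trans)
  show "top_of_set (K - I) homeomorphic_space std_sphere (dim V)"
    using homeomorphic_imp_homeomorphic_space[OF bd] unit_balls_homeomorphic_std(3)[OF V]
    by (rule homeomorphic_space_trans)
qed

text \<open>Raises the modulus to the power p and keeps the argument; sgn 0 = 0 takes care of the
  origin.\<close>

definition radial_power :: "real \<Rightarrow> complex \<Rightarrow> complex" where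
  "radial_power p z = cmod z powr p *\<^sub>R sgn z"

lemma radial_power_0 [simp]: "radial_power p 0 = 0"
  by (simp add: radial_power_def)

lemma norm_radial_power: "p > 0 \<Longrightarrow> cmod (radial_power p z) = cmod z powr p"
  by (cases "z = 0") (simp_all add: radial_power_def norm_sgn)

lemma sgn_radial_power: "sgn (radial_power p z) = sgn z"
  by (cases "z = 0") (simp_all add: radial_power_def sgn_scaleR)

lemma radial_power_radial_power: "p > 0 \<Longrightarrow> q > 0 \<Longrightarrow> radial_power p (radial_power q z) = radial_power (q * p) z"
  unfolding radial_power_def[of p] radial_power_def[of "q * p"]
  by (simp add: norm_radial_power sgn_radial_power powr_powr)

lemma radial_power_1: "radial_power 1 z = z"
  by (cases "z = 0") (simp_all add: radial_power_def sgn_div_norm)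

lemma radial_power_scaleR:
  "s > 0 \<Longrightarrow> radial_power p (s *\<^sub>R z) = (s powr p) *\<^sub>R radial_power p z"
  by (simp add: radial_power_def powr_mult sgn_scaleR)

lemma continuous_on_radial_power:
  assumes p: "p > 0"
  shows "continuous_on UNIV (radial_power p)"
proof -
  have "isCont (radial_power p) z" for z
  proof (cases "z = 0")
    case True
    have "continuous_on UNIV (\<lambda>z :: complex. cmod z powr p)"
      using p by (intro continuous_on_powr' continuous_intros) auto
    then have "isCont (\<lambda>z :: complex. cmod z powr p) 0"
      by (simp add: continuous_on_eq_continuous_at)
    then have "((\<lambda>z. cmod (radial_power p z)) \<longlongrightarrow> 0) (at 0)"
      using p by (simp add: isCont_def norm_radial_power)
    then show ?thesis
      using True by (simp add: isCont_def tendsto_norm_zero_iff)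
  next
    case False
    then show ?thesis
      unfolding radial_power_def by (intro continuous_intros) auto
  qed
  then show ?thesis
    by (simp add: continuous_on_eq_continuous_at)
qed

section \<open>Straightened coordinates and the conclusion\<close>

context gradient_setting
begin

text \<open>On the positions that carry \<open>E\<close> this is the contraction rate of the flow.
  The value 1 elsewhere keeps all exponents positive, so that both maps are continuous on all
  matrices.\<close>

definition weight :: "'n \<Rightarrow> 'n \<Rightarrow> real" where
  "weight i j = (if l i < l j then a j - a i else 1)"

lemma weight_gt_0: "weight i j > 0"
  using weight_pos[of i j] by (simp add: weight_def)

definition straighten :: "'n cmat \<Rightarrow> 'n cmat" where
  "straighten x = (\<chi> i j. radial_power (1 / weight i j) (x $ i $ j))"

definition unstraighten :: "'n cmat \<Rightarrow> 'n cmat" where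
  "unstraighten x = (\<chi> i j. radial_power (weight i j) (x $ i $ j))"

lemma straighten_homeomorphism: "homeomorphism E E unstraighten straighten"
proof (rule homeomorphismI)
  have entry: "continuous_on UNIV (\<lambda>x :: 'n cmat. x $ i $ j)" for i j
    by (intro continuous_intros)
  have "continuous_on UNIV (\<lambda>x :: 'n cmat. radial_power p (x $ i $ j))" if "p > 0" for p i j
    by (rule continuous_on_compose2[OF continuous_on_radial_power[OF that] entry]) simp
  then have "continuous_on UNIV straighten" "continuous_on UNIV unstraighten"
    using weight_gt_0 by (auto simp: straighten_def unstraighten_def intro!: continuous_on_matrix_entries)
  then show "continuous_on E straighten" "continuous_on E unstraighten"
    using continuous_on_subset by blast+
  show "unstraighten ` E \<subseteq> E" "straighten ` E \<subseteq> E"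
    by (auto simp: E_def straighten_def unstraighten_def)
  show "straighten (unstraighten x) = x" "unstraighten (straighten x) = x" for x
    using weight_gt_0
    by (auto simp: vec_eq_iff straighten_def unstraighten_def radial_power_radial_power radial_power_1
        less_imp_neq[THEN not_sym])
qed

lemma flow_unstraighten:
  assumes y: "y \<in> E"
  shows "flow t (unstraighten y) = unstraighten (exp (- t) *\<^sub>R y)"
proof -
  have "flow t (unstraighten y) $ i $ j = unstraighten (exp (- t) *\<^sub>R y) $ i $ j" for i j
  proof (cases "l i < l j")
    case True
    then have "exp (t * (a i - a j)) = exp (- t) powr weight i j"
      by (simp add: powr_def weight_def algebra_simps)
    then show ?thesis
      by (simp add: flow_def unstraighten_def radial_power_scaleR) (simp add: scaleR_conv_of_real)
  next
    case False
    then have "y $ i $ j = 0"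
      using y by (simp add: E_def)
    then show ?thesis
      by (simp add: flow_def unstraighten_def)
  qed
  then show ?thesis
    by (simp add: vec_eq_iff)
qed

lemma stable_manifold_subset_cell: "stable_manifold lam mu N \<subseteq> cell"
proof
  fix L0 assume "L0 \<in> stable_manifold lam mu N"
  then obtain L where L: "kahler_flow lam (trace_fun N) L" "L 0 = L0" "(L \<longlongrightarrow> chart 0) at_top"
    unfolding stable_manifold_def attractor_eq by blast
  obtain \<eta> where "openin (top_of_set (orbit lam)) cell"
    using chart_homeomorphism by blast
  then obtain Q where Q: "open Q" "cell = orbit lam \<inter> Q"
    unfolding openin_open by blast
  have "chart 0 \<in> cell"
    using subspace_0[OF subspace_E] by (simp add: cell_def)
  then have "\<forall>\<^sub>F t in at_top. L t \<in> Q"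
    using topological_tendstoD[OF L(3) Q(1)] Q(2) by blast
  then obtain T where "L T \<in> Q"
    unfolding eventually_at_top_linorder by blast
  moreover have "L T \<in> orbit lam"
    using L(1) by (simp add: kahler_flow_def)
  ultimately have "L T \<in> chart ` E"
    using Q(2) by (simp add: cell_def)
  then obtain y where y: "y \<in> E" "L T = chart y"
    by (elim imageE)
  \<comment> \<open>The starting point is found by running the linear flow backwards from
    \<open>y\<close>; its formula makes sense for all real times and preserves
    \<open>E\<close>.\<close>
  have x: "flow (- T) y \<in> E"
    using y(1) by (rule flow_mem_E)
  have "L 0 = chart (flow 0 (flow (- T) y))"
  proof (rule kahler_flow_unique[OF L(1) kahler_flow_chart[OF x]])
    show "L T = chart (flow T (flow (- T) y))"
      by (simp add: flow_flow y(2))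
  qed
  then show "L0 \<in> cell"
    using x L(2) by (simp add: cell_def)
qed

lemma inward_set_homeomorphic_balls:
  assumes ne: "S \<noteq> {}" and comp: "compact S" and stable: "S \<subseteq> stable_manifold lam mu N"
    and inward: "\<And>L t. kahler_flow lam (trace_fun N) L \<Longrightarrow> L 0 \<in> S \<Longrightarrow> t > 0 \<Longrightarrow>
      L t \<in> top_of_set (orbit lam) interior_of S"
  shows "top_of_set S homeomorphic_space std_cball (dim E) \<and>
    top_of_set (top_of_set (orbit lam) interior_of S) homeomorphic_space std_ball (dim E) \<and>
    top_of_set (S - top_of_set (orbit lam) interior_of S) homeomorphic_space std_sphere (dim E)"
proof -
  define S' where "S' = top_of_set (orbit lam) interior_of S"
  have S'_sub: "S' \<subseteq> S" and S'_open: "openin (top_of_set (orbit lam)) S'"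
    by (simp_all add: S'_def interior_of_subset)
  obtain \<eta> where "homeomorphism E cell chart \<eta>"
    using chart_homeomorphism by blast
  then have "homeomorphism E cell (chart \<circ> unstraighten) (straighten \<circ> \<eta>)"
    by (rule homeomorphism_compose[OF straighten_homeomorphism])
  then obtain \<Phi> \<Psi> where Phi_def: "\<Phi> = chart \<circ> unstraighten" and hom: "homeomorphism E cell \<Phi> \<Psi>"
    by blast
  have S_cell: "S \<subseteq> cell"
    using stable stable_manifold_subset_cell by (rule order_trans)
  define K where "K = \<Psi> ` S"
  define I where "I = \<Psi> ` S'"
  have inv_hom: "homeomorphism T (\<Psi> ` T) \<Psi> \<Phi>" if "T \<subseteq> S" for T
    using homeomorphism_of_subsets[OF homeomorphism_symD[OF hom], of T E "\<Psi> ` T"] that S_cell by blast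
  have Phi_Psi: "\<Phi> (\<Psi> L) = L" if "L \<in> S" for L
    using homeomorphism_apply2[OF hom] that S_cell by blast
  have Psi_Phi: "\<Psi> (\<Phi> y) = y" if "y \<in> E" for y
    using homeomorphism_apply1[OF hom that] .
  have Psi_E: "\<Psi> L \<in> E" if "L \<in> S" for L
    using homeomorphism_image2[OF hom] that S_cell by blast
  have I_eq: "I = {y \<in> E. \<Phi> y \<in> S'}"
  proof (intro equalityI subsetI)
    fix y assume "y \<in> I"
    then obtain L where "L \<in> S'" "y = \<Psi> L"
      unfolding I_def by (elim imageE)
    then show "y \<in> {y \<in> E. \<Phi> y \<in> S'}"
      using Phi_Psi Psi_E S'_sub by auto
  next
    fix y assume "y \<in> {y \<in> E. \<Phi> y \<in> S'}"
    then show "y \<in> I"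
      unfolding I_def using Psi_Phi[of y] by (intro image_eqI[of _ _ "\<Phi> y"]) auto
  qed
  have "inj_on \<Psi> S"
    using Phi_Psi by (rule inj_on_inverseI)
  then have K_diff: "\<Psi> ` (S - S') = K - I"
    unfolding K_def I_def by (rule inj_on_image_set_diff) (use S'_sub in auto)
  have K_E: "K \<subseteq> E"
    using Psi_E by (auto simp: K_def)
  have K_comp: "compact K"
    unfolding K_def using comp homeomorphism_cont1[OF inv_hom[OF order_refl]]
    by (intro compact_continuous_image)
  have K_ne: "K \<noteq> {}"
    using ne by (simp add: K_def)
  have I_K: "I \<subseteq> K"
    unfolding I_def K_def using S'_sub by (rule image_mono)
  have I_open: "openin (top_of_set E) I"
  proof -
    have "\<Phi> \<in> E \<rightarrow> orbit lam"
    proof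
      fix y assume "y \<in> E"
      then have "unstraighten y \<in> E"
        using homeomorphism_image1[OF straighten_homeomorphism] by blast
      then show "\<Phi> y \<in> orbit lam"
        by (simp add: Phi_def chart_in_orbit)
    qed
    then have "openin (top_of_set E) (E \<inter> \<Phi> -` S')"
      using S'_open by (rule continuous_openin_preimage[OF homeomorphism_cont1[OF hom]])
    moreover have "E \<inter> \<Phi> -` S' = I"
      by (auto simp: I_eq)
    ultimately show ?thesis
      by simp
  qed
  have star: "s *\<^sub>R y \<in> I" if y: "y \<in> K" and s: "0 < s" "s < 1" for y s
  proof -
    have yE: "y \<in> E" and yS: "\<Phi> y \<in> S"
      using y Psi_E Phi_Psi by (auto simp: K_def)
    have uE: "unstraighten y \<in> E"
      using homeomorphism_image1[OF straighten_homeomorphism] yE by blast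
    \<comment> \<open>Flowing for the time - ln s > 0 is scaling by exp (ln s) = s in the
      straightened coordinates.\<close>
    have "chart (flow (- ln s) (unstraighten y)) \<in> top_of_set (orbit lam) interior_of S"
    proof (rule inward[OF kahler_flow_chart[OF uE]])
      show "chart (flow 0 (unstraighten y)) \<in> S"
        using yS by (simp add: Phi_def)
      show "- ln s > 0"
        using s by simp
    qed
    then have "\<Phi> (s *\<^sub>R y) \<in> S'"
      using s by (simp add: S'_def Phi_def flow_unstraighten[OF yE])
    moreover have "s *\<^sub>R y \<in> E"
      using yE subspace_E by (simp add: subspace_scale)
    ultimately show "s *\<^sub>R y \<in> I"
      by (simp add: I_eq)
  qed
  have balls: "top_of_set K homeomorphic_space std_cball (dim E)"
    "top_of_set I homeomorphic_space std_ball (dim E)"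
    "top_of_set (K - I) homeomorphic_space std_sphere (dim E)"
    by (rule starlike_homeomorphic_balls[OF subspace_E K_E K_comp K_ne I_open I_K], rule star, assumption+)+
  have transfer: "top_of_set T homeomorphic_space top_of_set (\<Psi> ` T)" if "T \<subseteq> S" for T
    using inv_hom[OF that] by (intro homeomorphic_imp_homeomorphic_space) (auto simp: homeomorphic_def)
  show ?thesis
    unfolding S'_def[symmetric]
  proof (intro conjI)
    show "top_of_set S homeomorphic_space std_cball (dim E)"
      using transfer[OF order_refl] balls(1) unfolding K_def by (rule homeomorphic_space_trans)
    show "top_of_set S' homeomorphic_space std_ball (dim E)"
      using transfer[OF S'_sub] balls(2) unfolding I_def by (rule homeomorphic_space_trans)
    show "top_of_set (S - S') homeomorphic_space std_sphere (dim E)"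
      using transfer[of "S - S'", OF Diff_subset] balls(3) unfolding K_diff by (rule homeomorphic_space_trans)
  qed
qed

end

theorem theorem1p6:
  fixes lam mu :: "nat \<Rightarrow> real"
    and N :: "'n::{finite, linorder} cmat"
    and S :: "'n cmat set"
  assumes lam_decreasing: "antimono_on {1..CARD('n)} lam"
    and mu_decreasing: "antimono_on {1..CARD('n)} mu"
    and gaps: "\<And>k. k \<in> {1..<CARD('n)} \<Longrightarrow> lam k > lam (k + 1) \<Longrightarrow> mu k > mu (k + 1)"
    and N_skew: "N \<in> skew_herm"
    and N_orbit: "- N \<in> orbit mu"
    and S_nonempty: "S \<noteq> {}"
    and S_compact: "compact S"
    and S_stable: "S \<subseteq> stable_manifold lam mu N"
    and S_inward: "\<And>L t. kahler_flow lam (trace_fun N) L \<Longrightarrow> L 0 \<in> S \<Longrightarrow> t > 0 \<Longrightarrow>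
                     L t \<in> top_of_set (orbit lam) interior_of S"
  shows "\<exists>d. top_of_set S homeomorphic_space std_cball d \<and>
             top_of_set (top_of_set (orbit lam) interior_of S) homeomorphic_space std_ball d \<and>
             top_of_set (S - top_of_set (orbit lam) interior_of S) homeomorphic_space std_sphere d"
proof -
  obtain g where g: "g \<in> unitary_group" and Ng: "- N = orbit_pt (\<lambda>i. mu (idx i)) g"
    using N_orbit unfolding orbit_eq by (elim imageE)
  \<comment> \<open>- N has the eigenvalues \<i> mu, so multiplying it by - \<i> gives \<i>N with
    eigenvalues mu in the same basis \<open>g\<close>.\<close>
  have "cscale \<i> N = cscale (- \<i>) (- N)"
    by (simp add: vec_eq_iff)
  also have "\<dots> = cj g (dg (\<lambda>i. of_real (mu (idx i))))"
    unfolding Ng orbit_pt_def cj_cscale[symmetric] cscale_dg by simp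
  finally have N_eq: "cscale \<i> N = cj g (dg (\<lambda>i. of_real (mu (idx i))))" .
  interpret gradient_setting lam mu g N
    using lam_decreasing mu_decreasing gaps N_skew g N_eq by unfold_locales
  show ?thesis
    \<comment> \<open>This is the real dimension, twice the number of pairs with l i < l j. If
      \<open>lam\<close> is constant it is 0, the orbit is a point and the boundary is the empty
      \<open>std_sphere 0\<close>.\<close>
    by (rule exI[of _ "dim E"], rule inward_set_homeomorphic_balls[OF S_nonempty S_compact S_stable])
      (rule S_inward)
qed

end
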